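(* Suppose there is a constant $K$ such that any exact (self-transverse, chord generic) Lagrangian immersion $f\colon L\to\mathbb{C}^n$ of a closed manifold $L$ (for any $n$ and any $L$) has at least $$\frac12\dim(H_*(L;\Lambda))-K$$ double points, where $\Lambda=\mathbb{Q}$ or $\Lambda=\mathbb{Z}_p$ for any prime $p$ if $L$ is spin and $\Lambda=\mathbb{Z}_2$ if $L$ is not spin. Then any such $f$ has at least $$\frac12\dim(H_*(L;\Lambda))$$ double points.
   Context: A Lagrangian immersion $f\colon L\to\mathbb{C}^n$, with coordinates $x_j+iy_j$ on $\mathbb{C}^n$, is exact if the closed $1$-form $f^*(\sum_{j=1}^ny_j\,dx_j)$ is exact. Chord generic means that the Legendrian lift of $f$ to $\mathbb{C}^n\times\mathbb{R}$ (with contact form $dz-\sum y_jdx_j$) is an embedding and that all double points of $f$ are transverse, hence finitely many. *)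

theory Defs
  imports
    "HOL-Analysis.Analysis"
    "HOL-Homology.Homology"
    "HOL-Number_Theory.Residues"
begin

section \<open>Smooth functions on open subsets of Euclidean space\<close>

text \<open>
  Since the dimension \<open>n\<close> has to be quantified inside the statement, points of \<open>n\<close>-space are the
  sequences vanishing from index \<open>n\<close> on, as in \<^const>\<open>Euclidean_space\<close>.
\<close>

definition partial :: "nat \<Rightarrow> ((nat \<Rightarrow> real) \<Rightarrow> real) \<Rightarrow> (nat \<Rightarrow> real) \<Rightarrow> real" where
  "partial i g x = deriv (\<lambda>t. g (x(i := t))) (x i)"

primrec iter_partial :: "nat list \<Rightarrow> ((nat \<Rightarrow> real) \<Rightarrow> real) \<Rightarrow> (nat \<Rightarrow> real) \<Rightarrow> real" where
  "iter_partial [] g = g"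
| "iter_partial (i # is) g = partial i (iter_partial is g)"

text \<open>
  \<open>g\<close> is infinitely differentiable on \<open>S\<close>: all iterated partial derivatives exist and are
  continuous. Only used for \<open>S\<close> open in \<open>n\<close>-space, where values of \<open>g\<close> off \<open>S\<close> are irrelevant.
\<close>

definition smooth_on :: "nat \<Rightarrow> (nat \<Rightarrow> real) set \<Rightarrow> ((nat \<Rightarrow> real) \<Rightarrow> real) \<Rightarrow> bool" where
  "smooth_on n S g \<longleftrightarrow>
     (\<forall>is. set is \<subseteq> {..<n} \<longrightarrow>
        continuous_map (subtopology (Euclidean_space n) S) euclideanreal (iter_partial is g) \<and>
        (\<forall>x\<in>S. \<forall>i<n. (\<lambda>t. iter_partial is g (x(i := t))) differentiable (at (x i))))"


section \<open>Closed smooth manifolds\<close>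

type_synonym 'a chart = "'a set \<times> ('a \<Rightarrow> nat \<Rightarrow> real)"

text \<open>A function read in the coordinates of a chart.\<close>

definition in_chart :: "'a chart \<Rightarrow> ('a \<Rightarrow> 'b) \<Rightarrow> (nat \<Rightarrow> real) \<Rightarrow> 'b" where
  "in_chart c h = h \<circ> inv_into (fst c) (snd c)"

definition chart_on :: "nat \<Rightarrow> 'a topology \<Rightarrow> 'a chart \<Rightarrow> bool" where
  "chart_on n X c \<longleftrightarrow>
     openin X (fst c) \<and>
     openin (Euclidean_space n) (snd c ` fst c) \<and>
     homeomorphic_map (subtopology X (fst c))
       (subtopology (Euclidean_space n) (snd c ` fst c)) (snd c)"

definition smooth_atlas :: "nat \<Rightarrow> 'a topology \<Rightarrow> 'a chart set \<Rightarrow> bool" where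
  "smooth_atlas n X A \<longleftrightarrow>
     (\<forall>c\<in>A. chart_on n X c) \<and>
     (\<Union>c\<in>A. fst c) = topspace X \<and>
     (\<forall>c\<in>A. \<forall>d\<in>A. \<forall>i<n.
        smooth_on n (snd d ` (fst c \<inter> fst d)) (in_chart d (\<lambda>p. snd c p i)))"

text \<open>
  Compact without boundary, not necessarily connected. Second countability is automatic for a
  compact locally Euclidean space. Every closed manifold is diffeomorphic to one with underlying
  set in the type \<open>nat \<Rightarrow> real\<close>. An atlas determines the smooth structure, so it need not be
  maximal.
\<close>

definition closed_manifold :: "nat \<Rightarrow> 'a topology \<Rightarrow> 'a chart set \<Rightarrow> bool" where
  "closed_manifold n X A \<longleftrightarrow> Hausdorff_space X \<and> compact_space X \<and> smooth_atlas n X A"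

definition smooth_fun :: "nat \<Rightarrow> 'a chart set \<Rightarrow> ('a \<Rightarrow> real) \<Rightarrow> bool" where
  "smooth_fun n A h \<longleftrightarrow> (\<forall>c\<in>A. smooth_on n (snd c ` fst c) (in_chart c h))"

text \<open>
  The differential at \<open>p\<close>; a tangent vector is given by its components
  \<open>v 0, \<dots>, v (n - 1)\<close> in the chart \<open>c\<close>.
\<close>

definition diff_fun :: "nat \<Rightarrow> 'a chart \<Rightarrow> ('a \<Rightarrow> real) \<Rightarrow> 'a \<Rightarrow> (nat \<Rightarrow> real) \<Rightarrow> real" where
  "diff_fun n c h p v = (\<Sum>a<n. v a * partial a (in_chart c h) (snd c p))"


section \<open>Exact Lagrangian immersions\<close>

text \<open>Complex \<open>n\<close>-space, with coordinates \<open>z j = Complex (x j) (y j)\<close> for \<open>j < n\<close>.\<close>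

definition complex_space :: "nat \<Rightarrow> (nat \<Rightarrow> complex) set" where
  "complex_space n = {z. \<forall>j\<ge>n. z j = 0}"

definition diff_map ::
  "nat \<Rightarrow> 'a chart \<Rightarrow> ('a \<Rightarrow> nat \<Rightarrow> complex) \<Rightarrow> 'a \<Rightarrow> (nat \<Rightarrow> real) \<Rightarrow> nat \<Rightarrow> complex" where
  "diff_map n c f p v j =
     (if j < n then Complex (diff_fun n c (\<lambda>q. Re (f q j)) p v) (diff_fun n c (\<lambda>q. Im (f q j)) p v)
      else 0)"

text \<open>The image of the differential at \<open>p\<close>; every chart around \<open>p\<close> yields the same subspace.\<close>

definition tangent_image ::
  "nat \<Rightarrow> 'a chart set \<Rightarrow> ('a \<Rightarrow> nat \<Rightarrow> complex) \<Rightarrow> 'a \<Rightarrow> (nat \<Rightarrow> complex) set" where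
  "tangent_image n A f p = {diff_map n c f p v | c v. c \<in> A \<and> p \<in> fst c}"

definition immersion ::
  "nat \<Rightarrow> 'a topology \<Rightarrow> 'a chart set \<Rightarrow> ('a \<Rightarrow> nat \<Rightarrow> complex) \<Rightarrow> bool" where
  "immersion n X A f \<longleftrightarrow>
     (\<forall>p\<in>topspace X. f p \<in> complex_space n) \<and>
     (\<forall>j<n. smooth_fun n A (\<lambda>p. Re (f p j)) \<and> smooth_fun n A (\<lambda>p. Im (f p j))) \<and>
     (\<forall>c\<in>A. \<forall>p\<in>fst c. \<forall>v. (\<forall>j<n. diff_map n c f p v j = 0) \<longrightarrow> (\<forall>a<n. v a = 0))"

text \<open>The standard symplectic form, the sum of \<open>dx j \<and> dy j\<close>.\<close>

definition symplectic_form :: "nat \<Rightarrow> (nat \<Rightarrow> complex) \<Rightarrow> (nat \<Rightarrow> complex) \<Rightarrow> real" where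
  "symplectic_form n z w = (\<Sum>j<n. Re (z j) * Im (w j) - Im (z j) * Re (w j))"

text \<open>The manifold has dimension \<open>n\<close>, so isotropic means Lagrangian.\<close>

definition lagrangian_immersion ::
  "nat \<Rightarrow> 'a topology \<Rightarrow> 'a chart set \<Rightarrow> ('a \<Rightarrow> nat \<Rightarrow> complex) \<Rightarrow> bool" where
  "lagrangian_immersion n X A f \<longleftrightarrow>
     immersion n X A f \<and>
     (\<forall>c\<in>A. \<forall>p\<in>fst c. \<forall>v w. symplectic_form n (diff_map n c f p v) (diff_map n c f p w) = 0)"

text \<open>\<open>h\<close> is a smooth function whose differential is the pullback of the sum of \<open>y j dx j\<close>.\<close>

definition liouville_primitive ::
  "nat \<Rightarrow> 'a chart set \<Rightarrow> ('a \<Rightarrow> nat \<Rightarrow> complex) \<Rightarrow> ('a \<Rightarrow> real) \<Rightarrow> bool" where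
  "liouville_primitive n A f h \<longleftrightarrow>
     smooth_fun n A h \<and>
     (\<forall>c\<in>A. \<forall>p\<in>fst c. \<forall>v.
        diff_fun n c h p v = (\<Sum>j<n. Im (f p j) * Re (diff_map n c f p v j)))"

definition exact_lagrangian_immersion ::
  "nat \<Rightarrow> 'a topology \<Rightarrow> 'a chart set \<Rightarrow> ('a \<Rightarrow> nat \<Rightarrow> complex) \<Rightarrow> bool" where
  "exact_lagrangian_immersion n X A f \<longleftrightarrow>
     lagrangian_immersion n X A f \<and> (\<exists>h. liouville_primitive n A f h)"

text \<open>
  General position of the branches through a common image point: for distinct points
  \<open>p\<^sub>1, \<dots>, p\<^sub>k\<close> with the same image, the \<open>k\<close>-fold product of \<open>f\<close> is transverse to the diagonal
  at \<open>(p\<^sub>1, \<dots>, p\<^sub>k)\<close>. For two points this says that the two tangent images span; for \<open>n \<ge> 1\<close> it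
  excludes triple points.
\<close>

definition self_transverse ::
  "nat \<Rightarrow> 'a topology \<Rightarrow> 'a chart set \<Rightarrow> ('a \<Rightarrow> nat \<Rightarrow> complex) \<Rightarrow> bool" where
  "self_transverse n X A f \<longleftrightarrow>
     (\<forall>S w. finite S \<and> S \<subseteq> topspace X \<and> (\<forall>p\<in>S. \<forall>q\<in>S. f p = f q) \<and>
            (\<forall>p\<in>S. w p \<in> complex_space n) \<longrightarrow>
        (\<exists>u\<in>complex_space n. \<forall>p\<in>S. (\<lambda>j. w p j - u j) \<in> tangent_image n A f p))"

text \<open>
  The Legendrian lift \<open>(f, h)\<close> is determined by \<open>f\<close> up to adding a constant to \<open>h\<close> on each
  connected component. It is an immersion because \<open>f\<close> is, so it is an embedding as soon as it is
  a topological one.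
\<close>

definition chord_generic ::
  "nat \<Rightarrow> 'a topology \<Rightarrow> 'a chart set \<Rightarrow> ('a \<Rightarrow> nat \<Rightarrow> complex) \<Rightarrow> bool" where
  "chord_generic n X A f \<longleftrightarrow>
     (\<exists>h. liouville_primitive n A f h \<and> embedding_map X euclidean (\<lambda>p. (f p, h p))) \<and>
     (\<forall>p\<in>topspace X. \<forall>q\<in>topspace X. p \<noteq> q \<and> f p = f q \<longrightarrow>
        (\<forall>z\<in>complex_space n. \<exists>v\<in>tangent_image n A f p. \<exists>w\<in>tangent_image n A f q.
           z = (\<lambda>j. v j + w j)))"

definition double_points :: "'a topology \<Rightarrow> ('a \<Rightarrow> nat \<Rightarrow> complex) \<Rightarrow> (nat \<Rightarrow> complex) set" where
  "double_points X f =
     {z. \<exists>p\<in>topspace X. \<exists>q\<in>topspace X. p \<noteq> q \<and> f p = z \<and> f q = z}"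

definition num_double_points :: "'a topology \<Rightarrow> ('a \<Rightarrow> nat \<Rightarrow> complex) \<Rightarrow> ereal" where
  "num_double_points X f =
     (if finite (double_points X f) then ereal (real (card (double_points X f))) else \<infinity>)"


section \<open>Singular homology with coefficients in a field\<close>

definition rational_field :: "rat ring" where
  "rational_field = \<lparr>carrier = UNIV, monoid.mult = (*), one = 1, zero = 0, add = (+)\<rparr>"

type_synonym ('a, 'r) coeff_chain = "((nat \<Rightarrow> real) \<Rightarrow> 'a) \<Rightarrow> 'r"

definition coeff_chains ::
  "('r, 'm) ring_scheme \<Rightarrow> nat \<Rightarrow> 'a topology \<Rightarrow> ('a, 'r) coeff_chain set" where
  "coeff_chains R k X =
     {c. (\<forall>s. c s \<in> carrier R) \<and> finite {s. c s \<noteq> \<zero>\<^bsub>R\<^esub>} \<and>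
         (\<forall>s. c s \<noteq> \<zero>\<^bsub>R\<^esub> \<longrightarrow> singular_simplex k X s)}"

definition coeff_boundary ::
  "('r, 'm) ring_scheme \<Rightarrow> nat \<Rightarrow> ('a, 'r) coeff_chain \<Rightarrow> ('a, 'r) coeff_chain" where
  "coeff_boundary R k c =
     (\<lambda>t. if k = 0 then \<zero>\<^bsub>R\<^esub>
          else finsum R (\<lambda>(s, i). if even i then c s else \<ominus>\<^bsub>R\<^esub> c s)
                 {(s, i). c s \<noteq> \<zero>\<^bsub>R\<^esub> \<and> i \<le> k \<and> singular_face k i s = t})"

definition coeff_cycles ::
  "('r, 'm) ring_scheme \<Rightarrow> nat \<Rightarrow> 'a topology \<Rightarrow> ('a, 'r) coeff_chain set" where
  "coeff_cycles R k X = {c \<in> coeff_chains R k X. coeff_boundary R k c = (\<lambda>t. \<zero>\<^bsub>R\<^esub>)}"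

definition coeff_boundaries ::
  "('r, 'm) ring_scheme \<Rightarrow> nat \<Rightarrow> 'a topology \<Rightarrow> ('a, 'r) coeff_chain set" where
  "coeff_boundaries R k X = coeff_boundary R (Suc k) ` coeff_chains R (Suc k) X"

text \<open>The classes of \<open>z 0, \<dots>, z (d - 1)\<close> in cycles modulo boundaries are linearly independent.\<close>

definition independent_classes ::
  "('r, 'm) ring_scheme \<Rightarrow> nat \<Rightarrow> 'a topology \<Rightarrow> nat \<Rightarrow> (nat \<Rightarrow> ('a, 'r) coeff_chain) \<Rightarrow> bool" where
  "independent_classes R k X d z \<longleftrightarrow>
     (\<forall>i<d. z i \<in> coeff_cycles R k X) \<and>
     (\<forall>a. (\<forall>i<d. a i \<in> carrier R) \<and>
          (\<lambda>s. finsum R (\<lambda>i. a i \<otimes>\<^bsub>R\<^esub> z i s) {..<d}) \<in> coeff_boundaries R k X \<longrightarrow>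
          (\<forall>i<d. a i = \<zero>\<^bsub>R\<^esub>))"

definition homology_dim :: "('r, 'm) ring_scheme \<Rightarrow> nat \<Rightarrow> 'a topology \<Rightarrow> ereal" where
  "homology_dim R k X = (SUP d\<in>{d. \<exists>z. independent_classes R k X d z}. ereal (real d))"

definition total_homology_dim :: "('r, 'm) ring_scheme \<Rightarrow> 'a topology \<Rightarrow> ereal" where
  "total_homology_dim R X = suminf (\<lambda>k. homology_dim R k X)"


section \<open>Spin manifolds\<close>

text \<open>
  The Clifford algebra of Euclidean \<open>n\<close>-space with \<open>v * v = - |v|\<^sup>2\<close>. An element is given by its
  coefficients on the basis \<open>e\<^sub>S\<close>, \<open>S \<subseteq> {..<n}\<close>, where \<open>e\<^sub>S\<close> is the product of the \<open>e\<^sub>i\<close>,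
  \<open>i \<in> S\<close>, in increasing order. Here \<open>e\<^sub>S * e\<^sub>T = clifford_sign S T * e\<^sub>U\<close> with \<open>U\<close> the symmetric
  difference: each \<open>t\<close> in \<open>T\<close> is moved past the larger elements of \<open>S\<close>, and
  \<open>e\<^sub>t * e\<^sub>t = -1\<close> when \<open>t\<close> also lies in \<open>S\<close>.
\<close>

type_synonym clifford = "nat set \<Rightarrow> real"

definition clifford_sign :: "nat set \<Rightarrow> nat set \<Rightarrow> real" where
  "clifford_sign S T = (- 1) ^ card {(s, t). s \<in> S \<and> t \<in> T \<and> t \<le> s}"

definition clifford_mult :: "nat \<Rightarrow> clifford \<Rightarrow> clifford \<Rightarrow> clifford" where
  "clifford_mult n a b =
     (\<lambda>U. \<Sum>(S, T) \<in> {(S, T). S \<subseteq> {..<n} \<and> T \<subseteq> {..<n} \<and> (S - T) \<union> (T - S) = U}.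
            clifford_sign S T * a S * b T)"

definition clifford_one :: clifford where
  "clifford_one = (\<lambda>S. if S = {} then 1 else 0)"

definition clifford_vector :: "nat \<Rightarrow> (nat \<Rightarrow> real) \<Rightarrow> clifford" where
  "clifford_vector n v = (\<lambda>S. \<Sum>i<n. if S = {i} then v i else 0)"

text \<open>The group \<open>Spin(n)\<close>: products of an even number of unit vectors.\<close>

inductive_set spin_group :: "nat \<Rightarrow> clifford set" for n :: nat where
  one: "clifford_one \<in> spin_group n"
| step: "\<lbrakk>a \<in> spin_group n; (\<Sum>i<n. (u i)\<^sup>2) = 1; (\<Sum>i<n. (v i)\<^sup>2) = 1\<rbrakk> \<Longrightarrow>
    clifford_mult n a (clifford_mult n (clifford_vector n u) (clifford_vector n v))
      \<in> spin_group n"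

text \<open>
  \<open>r\<close> is the matrix of the rotation \<open>v \<mapsto> a * v * a\<inverse>\<close> covered by \<open>a\<close>: the image of the \<open>j\<close>-th
  basis vector is the \<open>j\<close>-th column of \<open>r\<close>.
\<close>

definition spin_covers :: "nat \<Rightarrow> clifford \<Rightarrow> (nat \<Rightarrow> nat \<Rightarrow> real) \<Rightarrow> bool" where
  "spin_covers n a r \<longleftrightarrow>
     (\<forall>j<n. clifford_mult n a (clifford_vector n (\<lambda>i. if i = j then 1 else 0)) =
            clifford_mult n (clifford_vector n (\<lambda>i. r i j)) a)"

text \<open>The transition functions of the tangent bundle: the Jacobian from chart \<open>d\<close> to chart \<open>c\<close>.\<close>

definition jacobian :: "'a chart \<Rightarrow> 'a chart \<Rightarrow> 'a \<Rightarrow> nat \<Rightarrow> nat \<Rightarrow> real" where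
  "jacobian c d x i j = partial j (in_chart d (\<lambda>p. snd c p i)) (snd d x)"

text \<open>
  A spin structure is a principal \<open>Spin(n)\<close>-bundle together with an isomorphism of the tangent
  bundle with the vector bundle associated to it through \<open>Spin(n) \<rightarrow> SO(n)\<close>. It is given here by
  cocycles: \<open>V p\<close> is an open neighbourhood of \<open>p\<close> over which the bundle is trivialised, \<open>h p q\<close> are
  the transition functions of the \<open>Spin(n)\<close>-bundle (continuity into \<open>Spin(n)\<close> is continuity of all
  coefficients), and \<open>E p\<close> is the induced frame of the tangent bundle over \<open>V p\<close>, its
  vectors being the columns of a matrix in the coordinates of the chart \<open>c p\<close>. Indexing the
  trivialising cover by the points of the manifold is no restriction.
\<close>

definition spin :: "nat \<Rightarrow> 'a topology \<Rightarrow> 'a chart set \<Rightarrow> bool" where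
  "spin n X A \<longleftrightarrow>
     (\<exists>(V :: 'a \<Rightarrow> 'a set) (c :: 'a \<Rightarrow> 'a chart)
        (E :: 'a \<Rightarrow> 'a \<Rightarrow> nat \<Rightarrow> nat \<Rightarrow> real) (h :: 'a \<Rightarrow> 'a \<Rightarrow> 'a \<Rightarrow> clifford).
        (\<forall>p\<in>topspace X.
           openin X (V p) \<and> p \<in> V p \<and> c p \<in> A \<and> V p \<subseteq> fst (c p) \<and>
           (\<forall>i<n. \<forall>j<n. continuous_map (subtopology X (V p)) euclideanreal (\<lambda>x. E p x i j)) \<and>
           (\<forall>x\<in>V p. \<forall>v. (\<forall>i<n. (\<Sum>j<n. E p x i j * v j) = 0) \<longrightarrow> (\<forall>j<n. v j = 0))) \<and>
        (\<forall>p\<in>topspace X. \<forall>q\<in>topspace X.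
           (\<forall>S. continuous_map (subtopology X (V p \<inter> V q)) euclideanreal (\<lambda>x. h p q x S)) \<and>
           (\<forall>x\<in>V p \<inter> V q. h p q x \<in> spin_group n \<and>
              (\<exists>r. spin_covers n (h p q x) r \<and>
                   (\<forall>i<n. \<forall>j<n. (\<Sum>k<n. jacobian (c p) (c q) x i k * E q x k j) =
                                 (\<Sum>k<n. E p x i k * r k j))))) \<and>
        (\<forall>p\<in>topspace X. \<forall>q\<in>topspace X. \<forall>r\<in>topspace X. \<forall>x\<in>V p \<inter> V q \<inter> V r.
           clifford_mult n (h p q x) (h q r x) = h p r x))"


section \<open>Admissible coefficient fields\<close>

text \<open>The dimensions of the total homology for all coefficient fields allowed for the manifold.\<close>

definition homology_dims :: "nat \<Rightarrow> 'a topology \<Rightarrow> 'a chart set \<Rightarrow> ereal set" where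
  "homology_dims n X A =
     (if spin n X A
      then insert (total_homology_dim rational_field X)
             {total_homology_dim (residue_ring (int p)) X | p :: nat. prime p}
      else {total_homology_dim (residue_ring 2) X})"

end

theory Submission
  imports Defs
begin

text \<open>
  A bound that is off by a constant improves itself, because both sides of it are additive under
  disjoint union while the error term is not. Let \<open>f\<close> be an exact immersion of \<open>L\<close> with \<open>N\<close> double
  points, and translate it \<open>m\<close> times along the \<open>x\<^sub>0\<close>-axis, far enough to make the images pairwise
  disjoint. Translations in the \<open>x\<close>-directions preserve the form \<open>\<Sum> y\<^sub>j dx\<^sub>j\<close>, so the union of the
  translates is again an exact, self-transverse and chord generic Lagrangian immersion, now of \<open>m\<close>
  disjoint copies of \<open>L\<close>. It has at most \<open>m N\<close> double points, and the homology of its domain has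
  \<open>m\<close> times the dimension. The hypothesis gives \<open>m dim H\<^sub>*(L) / 2 - K \<le> m N\<close> for every \<open>m\<close>;
  dividing by \<open>m\<close> and letting \<open>m\<close> grow gives the claim.

  Only inequalities are needed from the disjoint union: \<open>homology_dims_copies\<close> bounds its homology
  from below and \<open>num_double_points_copies\<close> its double points from above. The lower bound is proved
  by pushing independent cycles of \<open>L\<close> into each of the copies; they stay independent because a
  singular simplex is connected, so that chains can be restricted to a single copy compatibly with
  boundaries. A spin structure on \<open>L\<close> is put on every copy, so each coefficient field
  that is admissible for \<open>L\<close> stays admissible for the disjoint union.

  The hypothesis concerns manifolds whose points are real sequences. The \<open>i\<close>-th copy of a point is
  therefore encoded by \<open>i\<close> together with the image of the point under the Legendrian lift, which is
  injective.
\<close>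


section \<open>Smooth functions: locality and adding constants\<close>

lemma deriv_add_const: "deriv (\<lambda>t. g t + a) x = deriv g x" for g :: "real \<Rightarrow> real"
proof -
  have "((\<lambda>t. g t + a) has_field_derivative D) (at x) \<longleftrightarrow> (g has_field_derivative D) (at x)" for D
    using DERIV_add[of g D x UNIV "\<lambda>_. a" 0] DERIV_add[of "\<lambda>t. g t + a" D x UNIV "\<lambda>_. - a" 0]
    by auto
  then show ?thesis
    by (simp add: deriv_def)
qed

lemma iter_partial_add_const:
  "is \<noteq> [] \<Longrightarrow> iter_partial is (\<lambda>x. g x + a) = iter_partial is g"
proof (induction "is")
  case (Cons i "is")
  then show ?case
    by (cases "is = []") (auto simp: partial_def deriv_add_const fun_eq_iff)
qed simp

lemma partial_add_const: "partial i (\<lambda>x. g x + a) = partial i g"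
  using iter_partial_add_const[of "[i]" g a] by simp

lemma smooth_on_add_const:
  assumes "smooth_on n S g"
  shows "smooth_on n S (\<lambda>x. g x + a)"
  unfolding smooth_on_def
proof (intro allI impI)
  fix "is" :: "nat list" assume "is": "set is \<subseteq> {..<n}"
  show "continuous_map (subtopology (Euclidean_space n) S) euclideanreal (iter_partial is (\<lambda>x. g x + a)) \<and>
        (\<forall>x\<in>S. \<forall>i<n. (\<lambda>t. iter_partial is (\<lambda>x. g x + a) (x(i := t))) differentiable (at (x i)))"
  proof (cases "is = []")
    case True
    have "continuous_map (subtopology (Euclidean_space n) S) euclideanreal g"
      and "\<forall>x\<in>S. \<forall>i<n. (\<lambda>t. g (x(i := t))) differentiable (at (x i))"
      using assms by (auto simp: smooth_on_def dest: spec[of _ "[]"])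
    with True show ?thesis
      by (auto intro!: continuous_map_add differentiable_add)
  next
    case False
    with assms "is" show ?thesis
      by (simp add: iter_partial_add_const smooth_on_def)
  qed
qed

lemma continuous_map_fun_upd_Euclidean_space:
  assumes "x \<in> topspace (Euclidean_space n)" "i < n"
  shows "continuous_map euclideanreal (Euclidean_space n) (\<lambda>t. x(i := t))"
proof -
  have "(\<lambda>t. x(i := t)) = (\<lambda>t j. if j < n then (if j = i then t else x j) else 0)"
    using assms by (auto simp: fun_eq_iff topspace_Euclidean_space)
  then show ?thesis
    by (simp only: continuous_map_componentwise_Euclidean_space) auto
qed

lemma eventually_fun_upd_in_openin_Euclidean_space:
  assumes "openin (Euclidean_space n) S" "x \<in> S" "i < n"
  shows "\<forall>\<^sub>F t in nhds (x i). x(i := t) \<in> S"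
proof -
  have x: "x \<in> topspace (Euclidean_space n)"
    using assms openin_subset by blast
  have "openin euclideanreal {t \<in> topspace euclideanreal. x(i := t) \<in> S}"
    by (rule openin_continuous_map_preimage[OF continuous_map_fun_upd_Euclidean_space[OF x assms(3)] assms(1)])
  then have "open {t. x(i := t) \<in> S}"
    by simp
  then show ?thesis
    using assms(2) eventually_nhds_in_open[of "{t. x(i := t) \<in> S}" "x i"] by simp
qed

text \<open>
  The functions \<^const>\<open>in_chart\<close> have meaningless values off the image of the chart, and these
  values change when the chart is transported to a copy of the manifold. They do not matter, since
  derivatives at points of an open set are determined by the restriction to it.
\<close>

lemma partial_cong:
  assumes "openin (Euclidean_space n) S" "\<And>x. x \<in> S \<Longrightarrow> g x = g' x" "x \<in> S" "i < n"
  shows "partial i g x = partial i g' x"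
  unfolding partial_def
  by (rule deriv_cong_ev[OF _ refl], rule eventually_mono[OF eventually_fun_upd_in_openin_Euclidean_space[OF assms(1,3,4)]])
     (use assms in auto)

lemma iter_partial_cong:
  assumes "openin (Euclidean_space n) S" "\<And>x. x \<in> S \<Longrightarrow> g x = g' x" "set is \<subseteq> {..<n}" "x \<in> S"
  shows "iter_partial is g x = iter_partial is g' x"
  using assms(3,4)
proof (induction "is" arbitrary: x)
  case (Cons i "is")
  then show ?case
    by (auto intro!: partial_cong[OF assms(1)])
qed (use assms in auto)

lemma smooth_on_cong:
  assumes S: "openin (Euclidean_space n) S" and eq: "\<And>x. x \<in> S \<Longrightarrow> g x = g' x"
    and g: "smooth_on n S g"
  shows "smooth_on n S g'"
  unfolding smooth_on_def
proof (intro allI impI conjI ballI)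
  fix "is" :: "nat list" assume "is": "set is \<subseteq> {..<n}"
  have iter: "iter_partial is g x = iter_partial is g' x" if "x \<in> S" for x
    using iter_partial_cong[OF S eq "is" that] .
  show "continuous_map (subtopology (Euclidean_space n) S) euclideanreal (iter_partial is g')"
    by (rule continuous_map_eq[where f = "iter_partial is g"])
       (use g "is" iter in \<open>auto simp: smooth_on_def\<close>)
  fix x i assume x: "x \<in> S" and i: "i < n"
  have "(\<lambda>t. iter_partial is g (x(i := t))) differentiable at (x i)"
    using g "is" x i by (auto simp: smooth_on_def)
  then obtain D where D: "((\<lambda>t. iter_partial is g (x(i := t))) has_real_derivative D) (at (x i))"
    by (auto simp: real_differentiable_def)
  have "\<forall>\<^sub>F t in nhds (x i). iter_partial is g (x(i := t)) = iter_partial is g' (x(i := t))"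
    by (rule eventually_mono[OF eventually_fun_upd_in_openin_Euclidean_space[OF S x i]]) (rule iter)
  then have "((\<lambda>t. iter_partial is g' (x(i := t))) has_real_derivative D) (at (x i))"
    using D DERIV_cong_ev[OF refl _ refl] by metis
  then show "(\<lambda>t. iter_partial is g' (x(i := t))) differentiable at (x i)"
    by (auto simp: real_differentiable_def)
qed

lemma smooth_on_empty: "smooth_on n {} g"
  by (simp add: smooth_on_def)

section \<open>Disjoint unions of copies of a space\<close>

text \<open>
  The copies are described by injections \<open>e i\<close> with disjoint images instead of by pairs \<open>(i, p)\<close>, so
  that the disjoint union can be built inside a prescribed type.
\<close>

locale disjoint_copies =
  fixes m :: nat and X :: "'a topology" and e :: "nat \<Rightarrow> 'a \<Rightarrow> 'b"
  assumes e_inject: "\<lbrakk>i < m; j < m; p \<in> topspace X; q \<in> topspace X\<rbrakk> \<Longrightarrow> e i p = e j q \<longleftrightarrow> i = j \<and> p = q"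
begin

definition copies :: "'b topology" where
  "copies = topology (\<lambda>U. U \<subseteq> (\<Union>i<m. e i ` topspace X) \<and> (\<forall>i<m. openin X {p \<in> topspace X. e i p \<in> U}))"

definition base :: "'b \<Rightarrow> 'a" where
  "base y = snd (inv_into ({..<m} \<times> topspace X) (\<lambda>(i, p). e i p) y)"

definition index :: "'b \<Rightarrow> nat" where
  "index y = fst (inv_into ({..<m} \<times> topspace X) (\<lambda>(i, p). e i p) y)"

lemma inv_e: "inv_into ({..<m} \<times> topspace X) (\<lambda>(i, p). e i p) (e i p) = (i, p)"
  if "i < m" "p \<in> topspace X"
proof -
  have "inj_on (\<lambda>(i, p). e i p) ({..<m} \<times> topspace X)"
    by (auto simp: inj_on_def e_inject)
  from inv_into_f_f[OF this, of "(i, p)"] show ?thesis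
    using that by simp
qed

lemma base_e [simp]: "\<lbrakk>i < m; p \<in> topspace X\<rbrakk> \<Longrightarrow> base (e i p) = p"
  and index_e [simp]: "\<lbrakk>i < m; p \<in> topspace X\<rbrakk> \<Longrightarrow> index (e i p) = i"
  by (simp_all add: base_def index_def inv_e)

lemma openin_copies:
  "openin copies U \<longleftrightarrow> U \<subseteq> (\<Union>i<m. e i ` topspace X) \<and> (\<forall>i<m. openin X {p \<in> topspace X. e i p \<in> U})"
proof -
  have "istopology (\<lambda>U. U \<subseteq> (\<Union>i<m. e i ` topspace X) \<and> (\<forall>i<m. openin X {p \<in> topspace X. e i p \<in> U}))"
    unfolding istopology_def
  proof (intro conjI allI impI)
    fix S T i
    assume "S \<subseteq> (\<Union>i<m. e i ` topspace X) \<and> (\<forall>i<m. openin X {p \<in> topspace X. e i p \<in> S})"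
      "T \<subseteq> (\<Union>i<m. e i ` topspace X) \<and> (\<forall>i<m. openin X {p \<in> topspace X. e i p \<in> T})" and i: "i < m"
    then have "openin X ({p \<in> topspace X. e i p \<in> S} \<inter> {p \<in> topspace X. e i p \<in> T})"
      by blast
    then show "openin X {p \<in> topspace X. e i p \<in> S \<inter> T}"
      by (rule back_subst[of "openin X"]) auto
  next
    fix K i
    assume "\<forall>S\<in>K. S \<subseteq> (\<Union>i<m. e i ` topspace X) \<and> (\<forall>i<m. openin X {p \<in> topspace X. e i p \<in> S})"
      and "i < m"
    then have "openin X (\<Union>S\<in>K. {p \<in> topspace X. e i p \<in> S})"
      by blast
    then show "openin X {p \<in> topspace X. e i p \<in> \<Union>K}"
      by (rule back_subst[of "openin X"]) auto
  qed blast+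
  then show ?thesis
    by (simp add: copies_def topology_inverse')
qed

lemma topspace_copies: "topspace copies = (\<Union>i<m. e i ` topspace X)"
proof (rule antisym)
  have "{p \<in> topspace X. e i p \<in> (\<Union>i<m. e i ` topspace X)} = topspace X" if "i < m" for i
    using that by auto
  then show "(\<Union>i<m. e i ` topspace X) \<subseteq> topspace copies"
    by (intro openin_subset) (simp add: openin_copies)
qed (use openin_copies[of "topspace copies"] in simp)

lemma e_in_topspace [simp]: "\<lbrakk>i < m; p \<in> topspace X\<rbrakk> \<Longrightarrow> e i p \<in> topspace copies"
  by (auto simp: topspace_copies)

lemma copies_cases:
  assumes "y \<in> topspace copies"
  obtains i p where "i < m" "p \<in> topspace X" "y = e i p"
  using assms by (auto simp: topspace_copies)

lemma openin_copy:
  assumes "i < m" "openin X U"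
  shows "openin copies (e i ` U)"
proof -
  have U: "U \<subseteq> topspace X"
    using assms openin_subset by blast
  have "{p \<in> topspace X. e j p \<in> e i ` U} = (if i = j then U else {})" if "j < m" for j
    using U that assms by (auto simp: e_inject subset_iff image_iff)
  then show ?thesis
    using assms U unfolding openin_copies by (intro conjI) (blast, auto)
qed

lemma continuous_map_e: "i < m \<Longrightarrow> continuous_map X copies (e i)"
  by (auto simp: continuous_map_def openin_copies)

text \<open>The universal property of the disjoint union.\<close>

lemma continuous_map_copies:
  assumes "\<And>i. i < m \<Longrightarrow> continuous_map X Z (\<lambda>p. g (e i p))"
  shows "continuous_map copies Z g"
proof -
  have "openin copies {y \<in> topspace copies. g y \<in> W}" if "openin Z W" for W
  proof -
    have "{y \<in> topspace copies. g y \<in> W} = (\<Union>i<m. e i ` {p \<in> topspace X. g (e i p) \<in> W})"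
      by (auto simp: topspace_copies)
    moreover have "openin copies (e i ` {p \<in> topspace X. g (e i p) \<in> W})" if "i < m" for i
      using openin_copy[OF that] openin_continuous_map_preimage[OF assms[OF that] \<open>openin Z W\<close>] by simp
    ultimately show ?thesis
      by auto
  qed
  moreover have "g ` topspace copies \<subseteq> topspace Z"
    using assms by (force simp: topspace_copies continuous_map_def)
  ultimately show ?thesis
    by (auto simp: continuous_map_def)
qed

lemma continuous_map_base: "continuous_map copies X base"
  by (rule continuous_map_copies, rule continuous_map_eq[OF continuous_map_id]) simp

lemma continuous_map_index: "continuous_map copies (discrete_topology UNIV) index"
  by (rule continuous_map_copies, rule continuous_map_eq[OF continuous_map_const[THEN iffD2]]) auto

lemma base_image_copy: "\<lbrakk>i < m; U \<subseteq> topspace X\<rbrakk> \<Longrightarrow> base ` e i ` U = U"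
  by (force simp: image_iff subset_iff)

lemma continuous_map_subtopology_copy:
  assumes "i < m" "U \<subseteq> topspace X" and g: "continuous_map (subtopology X U) Z (\<lambda>p. g (e i p))"
  shows "continuous_map (subtopology copies (e i ` U)) Z g"
proof -
  have "continuous_map (subtopology copies (e i ` U)) (subtopology X U) base"
    using assms by (auto simp: continuous_map_in_subtopology
        intro: continuous_map_from_subtopology continuous_map_base)
  then have "continuous_map (subtopology copies (e i ` U)) Z ((\<lambda>p. g (e i p)) \<circ> base)"
    using g continuous_map_compose by blast
  then show ?thesis
    by (rule continuous_map_eq) (use assms in auto)
qed

lemma copies_disjoint:
  "\<lbrakk>i < m; j < m; U \<subseteq> topspace X; V \<subseteq> topspace X\<rbrakk> \<Longrightarrow>
    e i ` U \<inter> e j ` V = (if i = j then e i ` (U \<inter> V) else {})"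
  by (auto simp: e_inject subset_iff image_iff)

lemma compact_space_copies:
  assumes "compact_space X"
  shows "compact_space copies"
proof -
  have "compactin copies (e i ` topspace X)" if "i < m" for i
    using image_compactin[OF _ continuous_map_e[OF that]] assms by (simp add: compact_space_def)
  then have "compactin copies (\<Union>i<m. e i ` topspace X)"
    by (intro compactin_Union) auto
  then show ?thesis
    by (simp add: compact_space_def topspace_copies)
qed

lemma Hausdorff_space_copies:
  assumes "Hausdorff_space X"
  shows "Hausdorff_space copies"
  unfolding Hausdorff_space_def
proof (intro allI impI, elim conjE)
  fix y z assume y: "y \<in> topspace copies" and z: "z \<in> topspace copies" and "y \<noteq> z"
  obtain i p where p: "i < m" "p \<in> topspace X" "y = e i p"
    using y by (cases rule: copies_cases)
  obtain j q where q: "j < m" "q \<in> topspace X" "z = e j q"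
    using z by (cases rule: copies_cases)
  show "\<exists>U V. openin copies U \<and> openin copies V \<and> y \<in> U \<and> z \<in> V \<and> disjnt U V"
  proof (cases "i = j")
    case True
    then have "p \<noteq> q"
      using \<open>y \<noteq> z\<close> p q by blast
    then obtain U V where UV: "openin X U" "openin X V" "p \<in> U" "q \<in> V" "disjnt U V"
      using assms p(2) q(2) by (metis Hausdorff_space_def)
    then have "disjnt (e i ` U) (e i ` V)"
      using copies_disjoint[OF p(1) p(1) UV(1,2)[THEN openin_subset]] by (simp add: disjnt_def)
    then show ?thesis
      using UV p q openin_copy True
      by (intro exI[of _ "e i ` U"] exI[of _ "e i ` V"]) simp
  next
    case False
    then have "disjnt (e i ` topspace X) (e j ` topspace X)"
      using copies_disjoint[of i j "topspace X" "topspace X"] p q by (auto simp: disjnt_def)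
    then show ?thesis
      using p q openin_copy[OF _ openin_topspace]
      by (intro exI[of _ "e i ` topspace X"] exI[of _ "e j ` topspace X"]) simp
  qed
qed

end

section \<open>Homology of a disjoint union\<close>

lemma singular_face_simplex_map_eq:
  assumes "j \<le> Suc k"
  shows "singular_face (Suc k) j (simplex_map (Suc k) g s) = simplex_map k g (singular_face (Suc k) j s)"
proof -
  have "simplical_face j x \<in> standard_simplex (Suc k)" if "x \<in> standard_simplex k" for x
    using simplical_face_in_standard_simplex[of "Suc k" j x] assms that by simp
  then show ?thesis
    by (auto simp: singular_face_def simplex_map_def restrict_def fun_eq_iff)
qed

lemma independent_classes_0: "independent_classes R k X 0 z"
  by (simp add: independent_classes_def)

lemma homology_dim_nonneg: "0 \<le> homology_dim R k X"
  unfolding homology_dim_def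
  by (rule SUP_upper2[of 0]) (auto simp: zero_ereal_def intro: exI[of _ undefined] independent_classes_0)

lemma singular_simplex_singular_face_Suc:
  "\<lbrakk>singular_simplex (Suc k) X s; j \<le> Suc k\<rbrakk> \<Longrightarrow> singular_simplex k X (singular_face (Suc k) j s)"
  using singular_simplex_singular_face[of "Suc k" X s j] by simp

context disjoint_copies begin

lemma singular_simplex_copy:
  "\<lbrakk>i < m; singular_simplex k X s\<rbrakk> \<Longrightarrow> singular_simplex k copies (simplex_map k (e i) s)"
  using singular_simplex_simplex_map continuous_map_e by blast

lemma simplex_map_base_e:
  assumes "i < m" "singular_simplex k X s"
  shows "simplex_map k base (simplex_map k (e i) s) = s"
proof -
  have "s x \<in> topspace X" if "x \<in> standard_simplex k" for x
    using assms(2) that by (auto simp: singular_simplex_def continuous_map_def)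
  moreover have "s \<in> extensional (standard_simplex k)"
    using assms(2) by (simp add: singular_simplex_def)
  ultimately show ?thesis
    using assms(1) by (auto simp: simplex_map_def restrict_def extensional_def fun_eq_iff)
qed

lemma simplex_map_e_eq_iff:
  assumes "i < m" "j < m" "singular_simplex k X s" "singular_simplex k X t"
  shows "simplex_map k (e i) s = simplex_map k (e j) t \<longleftrightarrow> i = j \<and> s = t"
proof
  assume eq: "simplex_map k (e i) s = simplex_map k (e j) t"
  then have "s = t"
    using simplex_map_base_e assms by metis
  obtain x where x: "x \<in> standard_simplex k"
    using nonempty_standard_simplex by blast
  then have "s x \<in> topspace X" "t x \<in> topspace X"
    using assms(3,4) by (auto simp: singular_simplex_def continuous_map_def)
  moreover have "e i (s x) = e j (t x)"
    using fun_cong[OF eq, of x] x by (simp add: simplex_map_def)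
  ultimately show "i = j \<and> s = t"
    using e_inject assms \<open>s = t\<close> by blast
qed simp

text \<open>
  The standard simplex is connected, so the index of the copy is constant along a singular simplex.
\<close>

lemma singular_simplex_copies_cases:
  assumes "singular_simplex k copies u"
  obtains i s where "i < m" "singular_simplex k X s" "u = simplex_map k (e i) s"
proof -
  let ?D = "standard_simplex k"
  let ?T = "subtopology (powertop_real UNIV) ?D"
  have u: "continuous_map ?T copies u" and ext: "u \<in> extensional ?D"
    using assms by (auto simp: singular_simplex_def)
  have "connectedin ?T ?D"
    by (simp add: connectedin_subtopology connectedin_standard_simplex)
  moreover have "continuous_map ?T (discrete_topology UNIV) (index \<circ> u)"
    using u continuous_map_index by (rule continuous_map_compose)
  ultimately have "connectedin (discrete_topology UNIV) ((index \<circ> u) ` ?D)"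
    by (intro connectedin_continuous_map_image)
  then obtain i where "(index \<circ> u) ` ?D \<subseteq> {i}"
    unfolding connectedin_discrete_topology by blast
  then have i: "index (u x) = i" if "x \<in> ?D" for x
    using that by auto
  have e_base: "e i (base (u x)) = u x \<and> i < m" if "x \<in> ?D" for x
  proof -
    have "u x \<in> topspace copies"
      using u that by (auto simp: continuous_map_def)
    then show ?thesis
      using i[OF that] by (cases rule: copies_cases) simp
  qed
  show thesis
  proof
    show "i < m"
      using e_base nonempty_standard_simplex by blast
    show "singular_simplex k X (simplex_map k base u)"
      using assms continuous_map_base by (rule singular_simplex_simplex_map)
    show "u = simplex_map k (e i) (simplex_map k base u)"
      using ext e_base by (auto simp: simplex_map_def restrict_def extensional_def fun_eq_iff)
  qed
qed

text \<open>
  The restriction of chains to the \<open>i\<close>-th copy, and extension by zero in the opposite direction.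
\<close>

definition pull :: "('r, 'q) ring_scheme \<Rightarrow> nat \<Rightarrow> nat \<Rightarrow> ('b, 'r) coeff_chain \<Rightarrow> ('a, 'r) coeff_chain" where
  "pull R k i c = (\<lambda>s. if singular_simplex k X s then c (simplex_map k (e i) s) else \<zero>\<^bsub>R\<^esub>)"

definition push :: "('r, 'q) ring_scheme \<Rightarrow> nat \<Rightarrow> nat \<Rightarrow> ('a, 'r) coeff_chain \<Rightarrow> ('b, 'r) coeff_chain" where
  "push R k i z = (\<lambda>u. if u \<in> simplex_map k (e i) ` singular_simplex_set k X
                        then z (simplex_map k base u) else \<zero>\<^bsub>R\<^esub>)"

lemma push_simplex_map:
  assumes "i < m" "j < m" "singular_simplex k X s"
  shows "push R k i z (simplex_map k (e j) s) = (if i = j then z s else \<zero>\<^bsub>R\<^esub>)"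
proof (cases "i = j")
  case True
  then show ?thesis
    using assms by (auto simp: push_def simplex_map_base_e)
next
  case False
  then have "simplex_map k (e j) s \<notin> simplex_map k (e i) ` singular_simplex_set k X"
    using assms simplex_map_e_eq_iff by fastforce
  with False show ?thesis
    by (simp add: push_def)
qed

lemma pull_push:
  assumes "i < m" "j < m" "z \<in> coeff_chains R k X"
  shows "pull R k j (push R k i z) = (if i = j then z else (\<lambda>s. \<zero>\<^bsub>R\<^esub>))"
proof -
  have "z s = \<zero>\<^bsub>R\<^esub>" if "\<not> singular_simplex k X s" for s
    using assms(3) that by (auto simp: coeff_chains_def)
  then show ?thesis
    using assms(1,2) by (auto simp: pull_def push_simplex_map fun_eq_iff)
qed

lemma push_in_coeff_chains:
  assumes "i < m" "z \<in> coeff_chains R k X" "\<zero>\<^bsub>R\<^esub> \<in> carrier R"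
  shows "push R k i z \<in> coeff_chains R k copies"
proof -
  have "{u. push R k i z u \<noteq> \<zero>\<^bsub>R\<^esub>} \<subseteq> simplex_map k (e i) ` {s. z s \<noteq> \<zero>\<^bsub>R\<^esub>}"
    using assms by (auto simp: push_def simplex_map_base_e split: if_splits)
  moreover have "finite {s. z s \<noteq> \<zero>\<^bsub>R\<^esub>}"
    using assms by (simp add: coeff_chains_def)
  ultimately have "finite {u. push R k i z u \<noteq> \<zero>\<^bsub>R\<^esub>}"
    using finite_surj by blast
  then show ?thesis
    using assms by (auto simp: coeff_chains_def push_def singular_simplex_copy)
qed

lemma pull_in_coeff_chains:
  assumes "i < m" "c \<in> coeff_chains R k copies" "\<zero>\<^bsub>R\<^esub> \<in> carrier R"
  shows "pull R k i c \<in> coeff_chains R k X"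
proof -
  have "finite {u. c u \<noteq> \<zero>\<^bsub>R\<^esub>}"
    using assms by (simp add: coeff_chains_def)
  moreover have "simplex_map k (e i) ` {s. pull R k i c s \<noteq> \<zero>\<^bsub>R\<^esub>} \<subseteq> {u. c u \<noteq> \<zero>\<^bsub>R\<^esub>}"
    by (auto simp: pull_def split: if_splits)
  ultimately have "finite (simplex_map k (e i) ` {s. pull R k i c s \<noteq> \<zero>\<^bsub>R\<^esub>})"
    by (rule rev_finite_subset)
  moreover have "inj_on (simplex_map k (e i)) {s. pull R k i c s \<noteq> \<zero>\<^bsub>R\<^esub>}"
    using assms(1) by (auto simp: inj_on_def pull_def simplex_map_e_eq_iff split: if_splits)
  ultimately have "finite {s. pull R k i c s \<noteq> \<zero>\<^bsub>R\<^esub>}"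
    using finite_imageD by blast
  then show ?thesis
    using assms by (auto simp: coeff_chains_def pull_def)
qed

text \<open>
  Restriction to a copy is a chain map: a simplex having some face in the \<open>i\<close>-th copy lies in that
  copy itself, so discarding the other copies removes no term from the boundary coefficient.
\<close>

lemma coeff_boundary_pull:
  assumes R: "abelian_group R" and i: "i < m" and c: "c \<in> coeff_chains R (Suc k) copies"
  shows "coeff_boundary R (Suc k) (pull R (Suc k) i c) = pull R k i (coeff_boundary R (Suc k) c)"
proof
  fix t
  interpret abelian_group R by (rule R)
  define A where "A = {(s, j). pull R (Suc k) i c s \<noteq> \<zero>\<^bsub>R\<^esub> \<and> j \<le> Suc k \<and> singular_face (Suc k) j s = t}"
  have lhs: "coeff_boundary R (Suc k) (pull R (Suc k) i c) t =
      finsum R (\<lambda>(s, j). if even j then pull R (Suc k) i c s else \<ominus>\<^bsub>R\<^esub> pull R (Suc k) i c s) A"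
    by (simp add: coeff_boundary_def A_def)
  have A_simplex: "singular_simplex (Suc k) X s" if "(s, j) \<in> A" for s j
    using that by (auto simp: A_def pull_def split: if_splits)
  show "coeff_boundary R (Suc k) (pull R (Suc k) i c) t = pull R k i (coeff_boundary R (Suc k) c) t"
  proof (cases "singular_simplex k X t")
    case False
    then have "A = {}"
      using A_simplex singular_simplex_singular_face_Suc by (fastforce simp: A_def)
    with False show ?thesis
      unfolding lhs by (simp add: pull_def)
  next
    case True
    define h where "h \<equiv> \<lambda>(s, j :: nat). (simplex_map (Suc k) (e i) s, j)"
    define B where "B = {(u, j). c u \<noteq> \<zero>\<^bsub>R\<^esub> \<and> j \<le> Suc k \<and> singular_face (Suc k) j u = simplex_map k (e i) t}"
    have "B = h ` A"
    proof (intro equalityI subsetI)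
      fix b assume "b \<in> h ` A"
      then obtain s j where sj: "(s, j) \<in> A" and b: "b = (simplex_map (Suc k) (e i) s, j)"
        by (auto simp: h_def)
      then show "b \<in> B"
        using A_simplex[OF sj] by (auto simp: A_def B_def pull_def singular_face_simplex_map_eq)
    next
      fix b assume "b \<in> B"
      then obtain u j where b: "b = (u, j)" and cu: "c u \<noteq> \<zero>\<^bsub>R\<^esub>" and j: "j \<le> Suc k"
        and face: "singular_face (Suc k) j u = simplex_map k (e i) t"
        by (auto simp: B_def)
      have "singular_simplex (Suc k) copies u"
        using c cu by (auto simp: coeff_chains_def)
      then obtain i' s where s: "i' < m" "singular_simplex (Suc k) X s" "u = simplex_map (Suc k) (e i') s"
        by (rule singular_simplex_copies_cases)
      have "simplex_map k (e i') (singular_face (Suc k) j s) = simplex_map k (e i) t"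
        using face s j by (simp add: singular_face_simplex_map_eq)
      then have "i' = i \<and> singular_face (Suc k) j s = t"
        using simplex_map_e_eq_iff[OF s(1) i singular_simplex_singular_face_Suc[OF s(2) j] True] by simp
      then have "(s, j) \<in> A"
        using s cu j by (simp add: A_def pull_def)
      then show "b \<in> h ` A"
        using b s \<open>i' = i \<and> _\<close> by (force simp: h_def)
    qed
    moreover have "inj_on h A"
      using i A_simplex by (auto simp: inj_on_def h_def simplex_map_e_eq_iff)
    moreover define F where "F = (\<lambda>(u, j :: nat). if even j then c u else \<ominus>\<^bsub>R\<^esub> c u)"
    moreover have F: "F \<in> h ` A \<rightarrow> carrier R"
      using c by (auto simp: F_def coeff_chains_def)
    ultimately have "finsum R F B = finsum R (\<lambda>a. F (h a)) A"
      using finsum_reindex[of F h A] by simp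
    also have "\<dots> =
        finsum R (\<lambda>(s, j). if even j then pull R (Suc k) i c s else \<ominus>\<^bsub>R\<^esub> pull R (Suc k) i c s) A"
      using c A_simplex by (intro finsum_cong') (auto simp: F_def h_def pull_def coeff_chains_def)
    finally show ?thesis
      unfolding lhs F_def B_def using True by (simp add: pull_def[of R k] coeff_boundary_def)
  qed
qed

text \<open>
  Every singular simplex lies in one of the copies. Through this lemma the vanishing of the boundary
  of an extended cycle follows from the fact that restriction commutes with boundaries.
\<close>

lemma coeff_chain_eq_zeroI:
  assumes "\<And>u. \<not> singular_simplex k copies u \<Longrightarrow> c u = \<zero>\<^bsub>R\<^esub>" "\<And>i. i < m \<Longrightarrow> pull R k i c = (\<lambda>s. \<zero>\<^bsub>R\<^esub>)"
  shows "c = (\<lambda>u. \<zero>\<^bsub>R\<^esub>)"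
proof
  fix u
  show "c u = \<zero>\<^bsub>R\<^esub>"
  proof (cases "singular_simplex k copies u")
    case True
    then obtain i s where "i < m" "singular_simplex k X s" "u = simplex_map k (e i) s"
      by (rule singular_simplex_copies_cases)
    then show ?thesis
      using fun_cong[OF assms(2)[of i], of s] by (simp add: pull_def)
  qed (use assms in simp)
qed

lemma push_in_coeff_cycles:
  assumes R: "abelian_group R" and i: "i < m" and z: "z \<in> coeff_cycles R k X"
  shows "push R k i z \<in> coeff_cycles R k copies"
proof -
  interpret abelian_group R by (rule R)
  have chain: "push R k i z \<in> coeff_chains R k copies"
    using push_in_coeff_chains[of i z R k] i z by (simp add: coeff_cycles_def)
  have "coeff_boundary R k (push R k i z) = (\<lambda>u. \<zero>\<^bsub>R\<^esub>)"
  proof (cases k)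
    case 0
    then show ?thesis
      by (simp add: coeff_boundary_def)
  next
    case (Suc k')
    show ?thesis
    proof (rule coeff_chain_eq_zeroI)
      fix u assume "\<not> singular_simplex k' copies u"
      then have "{(s, j). push R k i z s \<noteq> \<zero>\<^bsub>R\<^esub> \<and> j \<le> k \<and> singular_face k j s = u} = {}"
        using chain singular_simplex_singular_face_Suc unfolding Suc by (fastforce simp: coeff_chains_def)
      then show "coeff_boundary R k (push R k i z) u = \<zero>\<^bsub>R\<^esub>"
        by (simp only: coeff_boundary_def) simp
    next
      fix j assume j: "j < m"
      have "pull R k' j (coeff_boundary R k (push R k i z)) = coeff_boundary R k (pull R k j (push R k i z))"
        using coeff_boundary_pull[OF R j] chain unfolding Suc by simp
      also have "\<dots> = (\<lambda>s. \<zero>\<^bsub>R\<^esub>)"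
        using i j z by (auto simp: pull_push coeff_cycles_def coeff_boundary_def)
      finally show "pull R k' j (coeff_boundary R k (push R k i z)) = (\<lambda>s. \<zero>\<^bsub>R\<^esub>)" .
    qed
  qed
  with chain show ?thesis
    by (simp add: coeff_cycles_def)
qed

text \<open>
  The \<open>m * d\<close> classes are indexed by the quotient and the remainder modulo \<open>d\<close>: the copy and the
  class in it. Restricting a relation between them to one copy leaves a relation between the original
  \<open>d\<close> classes, whose coefficients are one block of length \<open>d\<close> of the given coefficients.
\<close>

lemma independent_classes_copies:
  assumes R: "ring R" and z: "independent_classes R k X d z"
  shows "independent_classes R k copies (m * d) (\<lambda>l. push R k (l div d) (z (l mod d)))"
  unfolding independent_classes_def
proof (intro conjI allI impI)
  interpret ring R by (rule R)
  have ab: "abelian_group R" by (rule local.abelian_group_axioms)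
  have cyc: "z j \<in> coeff_cycles R k X" if "j < d" for j
    using z that by (simp add: independent_classes_def)
  have div_mod: "l div d < m" "l mod d < d" if "l < m * d" for l
    using that by (simp add: less_mult_imp_div_less) (cases "d = 0"; use that in simp)
  {
    fix l assume "l < m * d"
    then show "push R k (l div d) (z (l mod d)) \<in> coeff_cycles R k copies"
      by (intro push_in_coeff_cycles[OF ab] div_mod cyc)
  }
  fix a l
  let ?w = "\<lambda>u. finsum R (\<lambda>l. a l \<otimes>\<^bsub>R\<^esub> push R k (l div d) (z (l mod d)) u) {..<m * d}"
  assume *: "(\<forall>l<m * d. a l \<in> carrier R) \<and> ?w \<in> coeff_boundaries R k copies" and l: "l < m * d"
  define i where "i = l div d"
  have i: "i < m"
    using div_mod[OF l] by (simp add: i_def)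
  have id: "i * d + j < m * d" if "j < d" for j
  proof -
    have "i * d + j < Suc i * d"
      using that by simp
    also have "\<dots> \<le> m * d"
      using i by (intro mult_le_mono1) simp
    finally show ?thesis .
  qed
  have z_carrier: "z j s \<in> carrier R" if "j < d" for j s
    using cyc[OF that] by (simp add: coeff_cycles_def coeff_chains_def)
  obtain c where c: "c \<in> coeff_chains R (Suc k) copies" and w: "?w = coeff_boundary R (Suc k) c"
    using * by (auto simp: coeff_boundaries_def)
  have "pull R k i ?w = (\<lambda>s. finsum R (\<lambda>j. a (i * d + j) \<otimes>\<^bsub>R\<^esub> z j s) {..<d})"
  proof
    fix s
    show "pull R k i ?w s = finsum R (\<lambda>j. a (i * d + j) \<otimes>\<^bsub>R\<^esub> z j s) {..<d}"
    proof (cases "singular_simplex k X s")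
      case False
      then have "z j s = \<zero>\<^bsub>R\<^esub>" if "j < d" for j
        using cyc[OF that] by (auto simp: coeff_cycles_def coeff_chains_def)
      then have "finsum R (\<lambda>j. a (i * d + j) \<otimes>\<^bsub>R\<^esub> z j s) {..<d} = \<zero>\<^bsub>R\<^esub>"
        using * id by (intro add.finprod_one_eqI) simp
      with False show ?thesis
        by (simp add: pull_def)
    next
      case True
      have block: "(\<lambda>j. i * d + j) ` {..<d} \<subseteq> {..<m * d}"
        using id by auto
      have outside: "l' div d \<noteq> i" if "l' \<in> {..<m * d} - (\<lambda>j. i * d + j) ` {..<d}" for l'
      proof
        assume "l' div d = i"
        then have eq: "l' = i * d + l' mod d"
          by (metis div_mult_mod_eq)
        have "l' \<in> (\<lambda>j. i * d + j) ` {..<d}"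
          by (rule image_eqI[where x = "l' mod d"], rule eq) (use that div_mod(2)[of l'] in simp)
        then show False
          using that by simp
      qed
      have "pull R k i ?w s = finsum R (\<lambda>l. a l \<otimes>\<^bsub>R\<^esub> push R k (l div d) (z (l mod d)) (simplex_map k (e i) s)) {..<m * d}"
        using True by (simp add: pull_def)
      also have "\<dots> = finsum R (\<lambda>l. a l \<otimes>\<^bsub>R\<^esub> z (l mod d) s) ((\<lambda>j. i * d + j) ` {..<d})"
        using * outside True i block div_mod z_carrier
        by (intro add.finprod_mono_neutral_cong_right) (auto simp: push_simplex_map)
      also have "\<dots> = finsum R (\<lambda>j. a (i * d + j) \<otimes>\<^bsub>R\<^esub> z ((i * d + j) mod d) s) {..<d}"
        using * block z_carrier div_mod by (intro finsum_reindex) (auto simp: inj_on_def)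
      also have "\<dots> = finsum R (\<lambda>j. a (i * d + j) \<otimes>\<^bsub>R\<^esub> z j s) {..<d}"
        using * id z_carrier by (intro finsum_cong') auto
      finally show ?thesis .
    qed
  qed
  moreover have "pull R k i ?w = coeff_boundary R (Suc k) (pull R (Suc k) i c)"
    unfolding coeff_boundary_pull[OF ab i c] w ..
  ultimately have "(\<lambda>s. finsum R (\<lambda>j. a (i * d + j) \<otimes>\<^bsub>R\<^esub> z j s) {..<d}) =
      coeff_boundary R (Suc k) (pull R (Suc k) i c)"
    by (rule trans[OF sym])
  moreover have "pull R (Suc k) i c \<in> coeff_chains R (Suc k) X"
    using pull_in_coeff_chains[OF i c] by simp
  ultimately have "(\<lambda>s. finsum R (\<lambda>j. a (i * d + j) \<otimes>\<^bsub>R\<^esub> z j s) {..<d}) \<in> coeff_boundaries R k X"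
    unfolding coeff_boundaries_def by (rule image_eqI)
  moreover have "\<forall>j<d. a (i * d + j) \<in> carrier R"
    using * id by blast
  ultimately have zero: "\<forall>j<d. a (i * d + j) = \<zero>\<^bsub>R\<^esub>"
    using z[unfolded independent_classes_def, THEN conjunct2, THEN spec, of "\<lambda>j. a (i * d + j)"]
    by (elim mp[OF _ conjI])
  have "a (i * d + l mod d) = \<zero>\<^bsub>R\<^esub>"
    by (rule zero[rule_format, OF div_mod(2)[OF l]])
  then show "a l = \<zero>\<^bsub>R\<^esub>"
    by (simp add: i_def)
qed

lemma homology_dim_copies:
  assumes "ring R"
  shows "ereal (real m) * homology_dim R k X \<le> homology_dim R k copies"
proof -
  have "ereal (real m) * homology_dim R k X =
      (SUP d\<in>{d. \<exists>z. independent_classes R k X d z}. ereal (real m) * ereal (real d))"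
    unfolding homology_dim_def
    by (rule SUP_ereal_mult_left[symmetric]) (auto intro!: exI[of _ 0] independent_classes_0)
  also have "\<dots> \<le> homology_dim R k copies"
  proof (rule SUP_least)
    fix d assume "d \<in> {d. \<exists>z. independent_classes R k X d z}"
    then have "\<exists>z. independent_classes R k copies (m * d) z"
      using independent_classes_copies[OF assms] by blast
    then show "ereal (real m) * ereal (real d) \<le> homology_dim R k copies"
      unfolding homology_dim_def by (intro SUP_upper2[of "m * d"]) auto
  qed
  finally show ?thesis .
qed

lemma total_homology_dim_copies:
  assumes "ring R"
  shows "ereal (real m) * total_homology_dim R X \<le> total_homology_dim R copies"
proof -
  have "ereal (real m) * total_homology_dim R X = suminf (\<lambda>k. ereal (real m) * homology_dim R k X)"
    unfolding total_homology_dim_def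
    by (rule suminf_cmult_ereal[symmetric]) (auto simp: homology_dim_nonneg)
  also have "\<dots> \<le> total_homology_dim R copies"
    unfolding total_homology_dim_def
    by (rule suminf_le_pos) (auto simp: homology_dim_copies[OF assms] homology_dim_nonneg)
  finally show ?thesis .
qed

end

lemma ring_rational_field: "ring rational_field"
  unfolding rational_field_def
  by (rule ringI) (auto simp: algebra_simps intro!: abelian_groupI monoidI exI[of _ "- _"])

lemma ring_residue_ring: "prime p \<Longrightarrow> ring (residue_ring (int p))"
proof -
  assume "prime p"
  then interpret residues "int p" "residue_ring (int p)"
    by unfold_locales (auto dest: prime_gt_1_nat)
  show ?thesis
    using cring cring.axioms(1) by blast
qed

section \<open>Smooth and spin structures on a disjoint union\<close>

lemma chart_onD:
  assumes "chart_on n X c"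
  shows "openin X (fst c)" "fst c \<subseteq> topspace X" "inj_on (snd c) (fst c)"
    "openin (Euclidean_space n) (snd c ` fst c)"
  using assms openin_subset[of X "fst c"]
  by (auto simp: chart_on_def homeomorphic_map_def Int_absorb1
      dest!: homeomorphic_imp_injective_map)

lemma openin_chart_image:
  assumes "chart_on n X c" "openin X U" "U \<subseteq> fst c"
  shows "openin (Euclidean_space n) (snd c ` U)"
proof -
  have "openin (subtopology X (fst c)) U"
    using assms by (simp add: openin_open_subtopology chart_on_def)
  moreover have "open_map (subtopology X (fst c)) (subtopology (Euclidean_space n) (snd c ` fst c)) (snd c)"
    using assms homeomorphic_imp_open_map by (auto simp: chart_on_def)
  ultimately have "openin (subtopology (Euclidean_space n) (snd c ` fst c)) (snd c ` U)"
    by (simp add: open_map_def)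
  then show ?thesis
    using assms(1) by (simp add: chart_on_def openin_open_subtopology)
qed

lemma in_chart_apply: "\<lbrakk>inj_on (snd c) (fst c); p \<in> fst c\<rbrakk> \<Longrightarrow> in_chart c h (snd c p) = h p"
  by (simp add: in_chart_def)

context disjoint_copies begin

definition copy_chart :: "nat \<Rightarrow> 'a chart \<Rightarrow> 'b chart" where
  "copy_chart i c = (e i ` fst c, snd c \<circ> base)"

definition copy_atlas :: "'a chart set \<Rightarrow> 'b chart set" where
  "copy_atlas A = (\<Union>i<m. copy_chart i ` A)"

lemma fst_copy_chart [simp]: "fst (copy_chart i c) = e i ` fst c"
  and snd_copy_chart [simp]: "snd (copy_chart i c) = snd c \<circ> base"
  by (simp_all add: copy_chart_def)

lemma copy_chart_image:
  "\<lbrakk>i < m; U \<subseteq> topspace X\<rbrakk> \<Longrightarrow> snd (copy_chart i c) ` e i ` U = snd c ` U"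
  by (simp only: snd_copy_chart image_comp[symmetric] base_image_copy)

lemma chart_on_copy:
  assumes i: "i < m" and c: "chart_on n X c"
  shows "chart_on n copies (copy_chart i c)"
proof -
  note c' = chart_onD[OF c]
  let ?E = "subtopology (Euclidean_space n) (snd c ` fst c)"
  have img: "snd (copy_chart i c) ` fst (copy_chart i c) = snd c ` fst c"
    using copy_chart_image[OF i c'(2)] by simp
  obtain g where g: "homeomorphic_maps (subtopology X (fst c)) ?E (snd c) g"
    using c by (auto simp: chart_on_def homeomorphic_map_maps)
  have "homeomorphic_maps (subtopology copies (e i ` fst c)) (subtopology X (fst c)) base (e i)"
    using i c'(2) base_image_copy[OF i c'(2)]
    by (auto simp: homeomorphic_maps_def continuous_map_in_subtopology subset_iff
        intro!: continuous_map_from_subtopology continuous_map_base continuous_map_e)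
  then have "homeomorphic_maps (subtopology copies (e i ` fst c)) ?E (snd c \<circ> base) (e i \<circ> g)"
    using g by (intro homeomorphic_maps_compose conjI)
  then have "homeomorphic_map (subtopology copies (e i ` fst c)) ?E (snd c \<circ> base)"
    by (auto simp: homeomorphic_map_maps)
  then show ?thesis
    unfolding chart_on_def img using openin_copy[OF i c'(1)] c'(4) by simp
qed

lemma in_chart_copy:
  assumes i: "i < m" and c: "chart_on n X c" and x: "x \<in> snd c ` fst c"
    and eq: "\<And>p. p \<in> fst c \<Longrightarrow> H (e i p) = h p"
  shows "in_chart (copy_chart i c) H x = in_chart c h x"
proof -
  obtain p where p: "p \<in> fst c" "x = snd c p"
    using x by blast
  have "p \<in> topspace X"
    using p chart_onD(2)[OF c] by blast
  then have "in_chart (copy_chart i c) H (snd (copy_chart i c) (e i p)) = H (e i p)"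
    using p chart_onD(3)[OF chart_on_copy[OF i c]] by (intro in_chart_apply) simp_all
  then show ?thesis
    using eq[OF p(1)] in_chart_apply[OF chart_onD(3)[OF c] p(1), of h] p i \<open>p \<in> topspace X\<close> by simp
qed

lemma partial_in_chart_copy:
  assumes i: "i < m" and c: "chart_on n X c" and p: "p \<in> U" and a: "a < n"
    and U: "openin X U" "U \<subseteq> fst c" and eq: "\<And>q. q \<in> U \<Longrightarrow> H (e i q) = h q"
  shows "partial a (in_chart (copy_chart i c) H) (snd c p) = partial a (in_chart c h) (snd c p)"
proof (rule partial_cong[OF openin_chart_image[OF c U] _ _ a])
  fix x assume "x \<in> snd c ` U"
  then obtain q where q: "q \<in> U" "x = snd c q"
    by blast
  then have "q \<in> fst c"
    using U by blast
  have "in_chart (copy_chart i c) H x = in_chart c (\<lambda>q. H (e i q)) x"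
    using q \<open>q \<in> fst c\<close> by (intro in_chart_copy[OF i c]) auto
  also have "\<dots> = in_chart c h x"
    using q \<open>q \<in> fst c\<close> by (simp add: in_chart_apply[OF chart_onD(3)[OF c]] eq)
  finally show "in_chart (copy_chart i c) H x = in_chart c h x" .
qed (use p in blast)

lemma smooth_on_in_chart_copy:
  assumes i: "i < m" and c: "chart_on n X c" and U: "openin X U" "U \<subseteq> fst c"
    and eq: "\<And>q. q \<in> fst c \<Longrightarrow> H (e i q) = h q"
    and h: "smooth_on n (snd c ` U) (in_chart c h)"
  shows "smooth_on n (snd c ` U) (in_chart (copy_chart i c) H)"
proof (rule smooth_on_cong[OF openin_chart_image[OF c U] _ h])
  fix x assume "x \<in> snd c ` U"
  then show "in_chart c h x = in_chart (copy_chart i c) H x"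
    using U by (intro in_chart_copy[OF i c, symmetric]) (auto simp: eq)
qed

lemma closed_manifold_copies:
  assumes "closed_manifold n X A"
  shows "closed_manifold n copies (copy_atlas A)"
proof -
  have A: "smooth_atlas n X A"
    using assms by (simp add: closed_manifold_def)
  have c: "chart_on n X c" if "c \<in> A" for c
    using A that by (simp add: smooth_atlas_def)
  have "smooth_on n (snd d' ` (fst c' \<inter> fst d')) (in_chart d' (\<lambda>p. snd c' p k))"
    if "c' \<in> copy_atlas A" "d' \<in> copy_atlas A" and k: "k < n" for c' d' k
  proof -
    obtain i cc where i: "i < m" "cc \<in> A" "c' = copy_chart i cc"
      using \<open>c' \<in> _\<close> by (auto simp: copy_atlas_def)
    obtain j d where j: "j < m" "d \<in> A" "d' = copy_chart j d"
      using \<open>d' \<in> _\<close> by (auto simp: copy_atlas_def)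
    note sub = chart_onD(2)[OF c[OF i(2)]] chart_onD(2)[OF c[OF j(2)]]
    show ?thesis
    proof (cases "i = j")
      case False
      then show ?thesis
        using copies_disjoint[OF i(1) j(1) sub] i j by (simp add: smooth_on_empty)
    next
      case True
      let ?U = "fst cc \<inter> fst d"
      have U: "openin X ?U"
        using chart_onD(1)[OF c] i j by blast
      have "snd d' ` (fst c' \<inter> fst d') = snd d ` ?U"
        using copies_disjoint[OF i(1) j(1) sub] copy_chart_image[OF j(1), of ?U d] sub i j True
        by (simp add: le_infI1)
      moreover have "smooth_on n (snd d ` ?U) (in_chart d' (\<lambda>p. snd c' p k))"
        unfolding j(3) using A i j k U sub
        by (intro smooth_on_in_chart_copy[OF j(1) c[OF j(2)], where h = "\<lambda>p. snd cc p k"])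
           (auto simp: smooth_atlas_def subset_iff)
      ultimately show ?thesis
        by simp
    qed
  qed
  moreover have "(\<Union>c\<in>copy_atlas A. fst c) = topspace copies"
  proof -
    have "(\<Union>c\<in>copy_atlas A. fst c) = (\<Union>i<m. e i ` (\<Union>c\<in>A. fst c))"
      by (auto simp: copy_atlas_def)
    then show ?thesis
      using A by (simp add: smooth_atlas_def topspace_copies)
  qed
  ultimately show ?thesis
    using assms c chart_on_copy Hausdorff_space_copies compact_space_copies
    by (auto simp: closed_manifold_def smooth_atlas_def copy_atlas_def)
qed

text \<open>
  The function on the disjoint union may differ from the given one by a constant on each copy, as the
  coordinates of a translated immersion do.
\<close>

lemma smooth_fun_copies:
  assumes A: "smooth_atlas n X A"
    and h: "smooth_fun n A h" and eq: "\<And>i p. \<lbrakk>i < m; p \<in> topspace X\<rbrakk> \<Longrightarrow> H (e i p) = h p + a i"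
  shows "smooth_fun n (copy_atlas A) H"
  unfolding smooth_fun_def
proof
  fix c' assume "c' \<in> copy_atlas A"
  then obtain i c where i: "i < m" and cA: "c \<in> A" and c': "c' = copy_chart i c"
    by (auto simp: copy_atlas_def)
  have c: "chart_on n X c"
    using A cA by (simp add: smooth_atlas_def)
  have "smooth_on n (snd c ` fst c) (\<lambda>x. in_chart c h x + a i)"
    using h cA by (auto simp: smooth_fun_def intro: smooth_on_add_const)
  then have "smooth_on n (snd c ` fst c) (in_chart c (\<lambda>p. h p + a i))"
    by (simp add: in_chart_def comp_def)
  then have "smooth_on n (snd c ` fst c) (in_chart c' H)"
    unfolding c' using eq[OF i] chart_onD(2)[OF c]
    by (intro smooth_on_in_chart_copy[OF i c chart_onD(1)[OF c]]) auto
  then show "smooth_on n (snd c' ` fst c') (in_chart c' H)"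
    using copy_chart_image[OF i chart_onD(2)[OF c]] c' by simp
qed

lemma diff_fun_copy:
  assumes i: "i < m" and c: "chart_on n X c" and p: "p \<in> fst c"
    and eq: "\<And>p. p \<in> topspace X \<Longrightarrow> H (e i p) = h p + a"
  shows "diff_fun n (copy_chart i c) H (e i p) v = diff_fun n c h p v"
proof -
  note c' = chart_onD[OF c]
  have "partial k (in_chart (copy_chart i c) H) (snd c p) = partial k (in_chart c h) (snd c p)" if "k < n" for k
  proof -
    have "partial k (in_chart (copy_chart i c) H) (snd c p) = partial k (in_chart c (\<lambda>p. h p + a)) (snd c p)"
      using p c'(1,2) eq by (intro partial_in_chart_copy[OF i c p that c'(1)]) auto
    also have "in_chart c (\<lambda>p. h p + a) = (\<lambda>x. in_chart c h x + a)"
      by (simp add: in_chart_def comp_def)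
    finally show ?thesis
      by (simp add: partial_add_const)
  qed
  moreover have "snd (copy_chart i c) (e i p) = snd c p"
    using p c'(2) i by auto
  ultimately show ?thesis
    by (simp add: diff_fun_def)
qed

lemma jacobian_copy:
  assumes i: "i < m" and c: "chart_on n X c" and d: "chart_on n X d" and x: "x \<in> fst c \<inter> fst d"
    and k: "k < n"
  shows "jacobian (copy_chart i c) (copy_chart i d) (e i x) j k = jacobian c d x j k"
proof -
  note c' = chart_onD[OF c] and d' = chart_onD[OF d]
  have "partial k (in_chart (copy_chart i d) (\<lambda>p. snd (copy_chart i c) p j)) (snd d x)
      = partial k (in_chart d (\<lambda>p. snd c p j)) (snd d x)"
    using i x d'(2) by (intro partial_in_chart_copy[OF i d _ k d'(1)]) auto
  moreover have "snd (copy_chart i d) (e i x) = snd d x"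
    using x d'(2) i by auto
  ultimately show ?thesis
    by (simp add: jacobian_def)
qed

text \<open>
  All data of the spin structure are copied along \<open>base\<close>. The trivialising sets of points in different
  copies are disjoint, so they impose no condition on the transition functions.
\<close>

lemma spin_copies:
  assumes A: "smooth_atlas n X A" and "spin n X A"
  shows "spin n copies (copy_atlas A)"
proof -
  obtain V c E h where
    frame_all: "\<forall>p\<in>topspace X.
      openin X (V p) \<and> p \<in> V p \<and> c p \<in> A \<and> V p \<subseteq> fst (c p) \<and>
      (\<forall>i<n. \<forall>j<n. continuous_map (subtopology X (V p)) euclideanreal (\<lambda>x. E p x i j)) \<and>
      (\<forall>x\<in>V p. \<forall>v. (\<forall>i<n. (\<Sum>j<n. E p x i j * v j) = 0) \<longrightarrow> (\<forall>j<n. v j = 0))" and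
    transition_all: "\<forall>p\<in>topspace X. \<forall>q\<in>topspace X.
      (\<forall>S. continuous_map (subtopology X (V p \<inter> V q)) euclideanreal (\<lambda>x. h p q x S)) \<and>
      (\<forall>x\<in>V p \<inter> V q. h p q x \<in> spin_group n \<and>
         (\<exists>r. spin_covers n (h p q x) r \<and>
              (\<forall>i<n. \<forall>j<n. (\<Sum>k<n. jacobian (c p) (c q) x i k * E q x k j) =
                            (\<Sum>k<n. E p x i k * r k j))))" and
    cocycle: "\<forall>p\<in>topspace X. \<forall>q\<in>topspace X. \<forall>r\<in>topspace X. \<forall>x\<in>V p \<inter> V q \<inter> V r.
      clifford_mult n (h p q x) (h q r x) = h p r x"
    using assms(2) unfolding spin_def by (elim exE conjE) (rule that)
  note frame = bspec[OF frame_all] and transition = bspec[OF bspec[OF transition_all]]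
  define V' where "V' = (\<lambda>y. e (index y) ` V (base y))"
  define c' where "c' = (\<lambda>y. copy_chart (index y) (c (base y)))"
  define E' where "E' = (\<lambda>y x. E (base y) (base x))"
  define h' where "h' = (\<lambda>y z x. h (base y) (base z) (base x))"
  have V: "V p \<subseteq> topspace X" "V p \<subseteq> fst (c p)" if "p \<in> topspace X" for p
    using frame[OF that] openin_subset by blast+
  have chart: "chart_on n X (c p)" if "p \<in> topspace X" for p
    using frame[OF that] A by (simp add: smooth_atlas_def)
  show ?thesis
    unfolding spin_def
  proof (rule exI[of _ V'], rule exI[of _ c'], rule exI[of _ E'], rule exI[of _ h'], intro conjI ballI)
    fix y assume "y \<in> topspace copies"
    then obtain i p where p: "i < m" "p \<in> topspace X" "y = e i p"
      by (rule copies_cases)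
    note f = frame[OF p(2)]
    have V'y: "V' y = e i ` V p"
      using p by (simp add: V'_def)
    show "openin copies (V' y)"
      unfolding V'y using f p openin_copy by blast
    show "y \<in> V' y"
      unfolding V'y using f p by blast
    show "c' y \<in> copy_atlas A"
      using f p by (auto simp: c'_def copy_atlas_def)
    show "V' y \<subseteq> fst (c' y)"
      using f p by (auto simp: V'_def c'_def)
    show "\<forall>k<n. \<forall>j<n. continuous_map (subtopology copies (V' y)) euclideanreal (\<lambda>x. E' y x k j)"
    proof (intro allI impI)
      fix k j assume "k < n" "j < n"
      then have "continuous_map (subtopology X (V p)) euclideanreal (\<lambda>x. E p x k j)"
        using f by blast
      then have "continuous_map (subtopology X (V p)) euclideanreal (\<lambda>x. E' y (e i x) k j)"
        by (rule continuous_map_eq) (use p in \<open>auto simp: E'_def\<close>)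
      then show "continuous_map (subtopology copies (V' y)) euclideanreal (\<lambda>x. E' y x k j)"
        unfolding V'y by (rule continuous_map_subtopology_copy[OF p(1) V(1)[OF p(2)]])
    qed
    fix x assume "x \<in> V' y"
    then obtain x0 where x0: "x0 \<in> V p" "x = e i x0"
      unfolding V'y by blast
    then have "base x = x0"
      using p V(1)[OF p(2)] by auto
    then show "\<forall>v. (\<forall>i<n. (\<Sum>j<n. E' y x i j * v j) = 0) \<longrightarrow> (\<forall>j<n. v j = 0)"
      using f x0 p by (simp add: E'_def)
  next
    fix y z assume "y \<in> topspace copies" "z \<in> topspace copies"
    then obtain i p j q where p: "i < m" "p \<in> topspace X" "y = e i p"
      and q: "j < m" "q \<in> topspace X" "z = e j q"
      by (metis copies_cases)
    have Int: "V' y \<inter> V' z = (if i = j then e i ` (V p \<inter> V q) else {})"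
      using copies_disjoint[OF p(1) q(1) V(1)[OF p(2)] V(1)[OF q(2)]] p q by (simp add: V'_def)
    note t = transition[OF p(2) q(2)]
    show "\<forall>S. continuous_map (subtopology copies (V' y \<inter> V' z)) euclideanreal (\<lambda>x. h' y z x S)"
    proof
      fix S
      have "continuous_map (subtopology X (V p \<inter> V q)) euclideanreal (\<lambda>x. h p q x S)"
        using t by blast
      then have "continuous_map (subtopology X (V p \<inter> V q)) euclideanreal (\<lambda>x. h' y z (e i x) S)"
        by (rule continuous_map_eq) (use p q in \<open>auto simp: h'_def\<close>)
      then have "continuous_map (subtopology copies (e i ` (V p \<inter> V q))) euclideanreal (\<lambda>x. h' y z x S)"
        using V(1)[OF p(2)] by (intro continuous_map_subtopology_copy[OF p(1)]) auto
      then show "continuous_map (subtopology copies (V' y \<inter> V' z)) euclideanreal (\<lambda>x. h' y z x S)"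
        unfolding Int by (cases "i = j") simp_all
    qed
    fix x assume "x \<in> V' y \<inter> V' z"
    then obtain x0 where ij: "i = j" and x0: "x0 \<in> V p \<inter> V q" "x = e i x0"
      unfolding Int by (auto split: if_splits)
    have base: "base x = x0" "base y = p" "base z = q"
      using p q x0 V(1)[OF p(2)] by auto
    have x0': "x0 \<in> fst (c p) \<inter> fst (c q)"
      using x0 V(2) p q by blast
    have jac: "jacobian (c' y) (c' z) x a k = jacobian (c p) (c q) x0 a k" if "k < n" for a k
      using jacobian_copy[OF p(1) chart[OF p(2)] chart[OF q(2)] x0' that] p q ij x0
      by (simp add: c'_def)
    show "h' y z x \<in> spin_group n"
      using t x0(1) by (simp add: h'_def base)
    show "\<exists>r. spin_covers n (h' y z x) r \<and>
        (\<forall>i<n. \<forall>j<n. (\<Sum>k<n. jacobian (c' y) (c' z) x i k * E' z x k j) = (\<Sum>k<n. E' y x i k * r k j))"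
      using t x0(1) by (simp add: h'_def E'_def base jac)
  next
    fix y z w x assume "y \<in> topspace copies" "z \<in> topspace copies" "w \<in> topspace copies"
      and x: "x \<in> V' y \<inter> V' z \<inter> V' w"
    then obtain i p j q l r where p: "i < m" "p \<in> topspace X" "y = e i p"
      and q: "j < m" "q \<in> topspace X" "z = e j q" and r: "l < m" "r \<in> topspace X" "w = e l r"
      by (metis copies_cases)
    obtain x1 x2 x3 where x': "x1 \<in> V p" "x = e i x1" "x2 \<in> V q" "x = e j x2" "x3 \<in> V r" "x = e l x3"
      using x p q r by (auto simp: V'_def)
    then have "base x \<in> V p \<inter> V q \<inter> V r"
      using p q r V(1) base_e by (metis IntI subsetD)
    then show "clifford_mult n (h' y z x) (h' z w x) = h' y w x"
      using cocycle p q r by (simp add: h'_def)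
  qed
qed

end

section \<open>Disjoint translates of an immersion\<close>

definition translate :: "real \<Rightarrow> (nat \<Rightarrow> complex) \<Rightarrow> nat \<Rightarrow> complex" where
  "translate t z = z(0 := z 0 + of_real t)"

lemma translate_eq_iff [simp]: "translate t z = translate t w \<longleftrightarrow> z = w"
  by (auto simp: translate_def fun_eq_iff split: if_splits)

lemma Re_translate: "Re (translate t z j) = Re (z j) + (if j = 0 then t else 0)"
  and Im_translate [simp]: "Im (translate t z j) = Im (z j)"
  by (simp_all add: translate_def)

lemma translate_in_complex_space: "\<lbrakk>n \<ge> 1; z \<in> complex_space n\<rbrakk> \<Longrightarrow> translate t z \<in> complex_space n"
  by (auto simp: complex_space_def translate_def)

lemma embedding_imp_continuous_map: "embedding_map X Y f \<Longrightarrow> continuous_map X Y f"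
  unfolding embedding_map_def
  using homeomorphic_imp_continuous_map continuous_map_into_fulltopology by blast

lemma embedding_imp_injective_map: "embedding_map X Y f \<Longrightarrow> inj_on f (topspace X)"
  unfolding embedding_map_def using homeomorphic_imp_injective_map by blast

text \<open>
  The last assumption says that the translates of the image by multiples of \<open>T\<close> are pairwise disjoint.
  It keeps the copies from meeting each other, so every double point comes from a single copy.
\<close>

locale immersion_copies = disjoint_copies m X e
  for m :: nat and X :: "'a topology" and e :: "nat \<Rightarrow> 'a \<Rightarrow> 'b" +
  fixes n :: nat and A :: "'a chart set" and f :: "'a \<Rightarrow> nat \<Rightarrow> complex" and T :: real
  assumes n: "n \<ge> 1" and manifold: "closed_manifold n X A"
    and separated: "\<lbrakk>i < m; j < m; p \<in> topspace X; q \<in> topspace X;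
      translate (real i * T) (f p) = translate (real j * T) (f q)\<rbrakk> \<Longrightarrow> i = j"
begin

definition copy_map :: "'b \<Rightarrow> nat \<Rightarrow> complex" where
  "copy_map y = translate (real (index y) * T) (f (base y))"

lemma copy_map_e [simp]:
  "\<lbrakk>i < m; p \<in> topspace X\<rbrakk> \<Longrightarrow> copy_map (e i p) = translate (real i * T) (f p)"
  by (simp add: copy_map_def)

lemma copy_map_eq_iff:
  "\<lbrakk>i < m; j < m; p \<in> topspace X; q \<in> topspace X\<rbrakk> \<Longrightarrow>
    copy_map (e i p) = copy_map (e j q) \<longleftrightarrow> i = j \<and> f p = f q"
  using separated[of i j p q] by (cases "i = j") auto

lemma atlas: "smooth_atlas n X A" and chart: "c \<in> A \<Longrightarrow> chart_on n X c"
  using manifold by (auto simp: closed_manifold_def smooth_atlas_def)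

lemma in_topspace: "\<lbrakk>c \<in> A; p \<in> fst c\<rbrakk> \<Longrightarrow> p \<in> topspace X"
  using chart chart_onD(2) by blast

lemma copy_atlas_cases:
  assumes "c' \<in> copy_atlas A" "y \<in> fst c'"
  obtains i c p where "i < m" "c \<in> A" "c' = copy_chart i c" "p \<in> fst c" "p \<in> topspace X" "y = e i p"
  using assms in_topspace by (auto simp: copy_atlas_def)

lemma diff_map_copy:
  assumes "i < m" "c \<in> A" "p \<in> fst c"
  shows "diff_map n (copy_chart i c) copy_map (e i p) v = diff_map n c f p v"
proof
  fix j
  have "diff_fun n (copy_chart i c) (\<lambda>q. Re (copy_map q j)) (e i p) v = diff_fun n c (\<lambda>q. Re (f q j)) p v"
    using assms by (intro diff_fun_copy[OF _ chart]) (auto simp: Re_translate)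
  moreover have "diff_fun n (copy_chart i c) (\<lambda>q. Im (copy_map q j)) (e i p) v = diff_fun n c (\<lambda>q. Im (f q j)) p v"
    using assms by (intro diff_fun_copy[OF _ chart, where a = 0]) auto
  ultimately show "diff_map n (copy_chart i c) copy_map (e i p) v j = diff_map n c f p v j"
    by (simp add: diff_map_def)
qed

lemma tangent_image_copy:
  assumes i: "i < m" and p: "p \<in> topspace X"
  shows "tangent_image n (copy_atlas A) copy_map (e i p) = tangent_image n A f p"
proof (intro equalityI subsetI)
  fix w assume "w \<in> tangent_image n (copy_atlas A) copy_map (e i p)"
  then obtain c' v where c': "c' \<in> copy_atlas A" "e i p \<in> fst c'" and w: "w = diff_map n c' copy_map (e i p) v"
    by (auto simp: tangent_image_def)
  from c' obtain j c q where q: "j < m" "c \<in> A" "c' = copy_chart j c" "q \<in> fst c" "q \<in> topspace X" "e i p = e j q"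
    by (rule copy_atlas_cases)
  moreover have "i = j" "p = q"
    using e_inject[OF i q(1) p q(5)] q(6) by simp_all
  ultimately have "c \<in> A" "p \<in> fst c" "w = diff_map n c f p v"
    using diff_map_copy[OF i] by (simp_all add: w)
  then show "w \<in> tangent_image n A f p"
    unfolding tangent_image_def by blast
next
  fix w assume "w \<in> tangent_image n A f p"
  then obtain c v where c: "c \<in> A" "p \<in> fst c" and w: "w = diff_map n c f p v"
    by (auto simp: tangent_image_def)
  have "copy_chart i c \<in> copy_atlas A" "e i p \<in> fst (copy_chart i c)"
    using i c by (auto simp: copy_atlas_def)
  then show "w \<in> tangent_image n (copy_atlas A) copy_map (e i p)"
    unfolding w diff_map_copy[OF i c, symmetric] tangent_image_def by blast
qed

lemma immersion_copies:
  assumes "immersion n X A f"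
  shows "immersion n copies (copy_atlas A) copy_map"
  unfolding immersion_def
proof (intro conjI ballI allI impI)
  fix y assume "y \<in> topspace copies"
  then obtain i p where "i < m" "p \<in> topspace X" "y = e i p"
    by (rule copies_cases)
  then show "copy_map y \<in> complex_space n"
    using assms n by (simp add: immersion_def translate_in_complex_space)
next
  fix j assume "j < n"
  then have "smooth_fun n A (\<lambda>p. Re (f p j))" "smooth_fun n A (\<lambda>p. Im (f p j))"
    using assms by (simp_all add: immersion_def)
  then show "smooth_fun n (copy_atlas A) (\<lambda>y. Re (copy_map y j))"
    "smooth_fun n (copy_atlas A) (\<lambda>y. Im (copy_map y j))"
    using smooth_fun_copies[OF atlas, of "\<lambda>p. Re (f p j)" "\<lambda>y. Re (copy_map y j)" "\<lambda>i. if j = 0 then real i * T else 0"]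
      smooth_fun_copies[OF atlas, of "\<lambda>p. Im (f p j)" "\<lambda>y. Im (copy_map y j)" "\<lambda>i. 0"]
    by (simp_all add: Re_translate)
next
  fix c' y v a
  assume "c' \<in> copy_atlas A" "y \<in> fst c'" and *: "\<forall>j<n. diff_map n c' copy_map y v j = 0" and "a < n"
  from this(1,2) obtain i c p where "i < m" "c \<in> A" "c' = copy_chart i c" "p \<in> fst c" "p \<in> topspace X" "y = e i p"
    by (rule copy_atlas_cases)
  then show "v a = 0"
    using assms * \<open>a < n\<close> by (simp add: immersion_def diff_map_copy)
qed

lemma lagrangian_immersion_copies:
  assumes "lagrangian_immersion n X A f"
  shows "lagrangian_immersion n copies (copy_atlas A) copy_map"
  unfolding lagrangian_immersion_def
proof (intro conjI ballI allI)
  show "immersion n copies (copy_atlas A) copy_map"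
    using assms immersion_copies by (simp add: lagrangian_immersion_def)
  fix c' y v w
  assume "c' \<in> copy_atlas A" "y \<in> fst c'"
  then obtain i c p where "i < m" "c \<in> A" "c' = copy_chart i c" "p \<in> fst c" "p \<in> topspace X" "y = e i p"
    by (rule copy_atlas_cases)
  then show "symplectic_form n (diff_map n c' copy_map y v) (diff_map n c' copy_map y w) = 0"
    using assms by (simp add: lagrangian_immersion_def diff_map_copy)
qed

text \<open>
  A translation in the direction of \<open>x\<^sub>0\<close> changes neither the functions \<open>y\<^sub>j\<close> nor the differentials
  \<open>dx\<^sub>j\<close>, so the same primitive serves on every copy.
\<close>

lemma liouville_primitive_copies:
  assumes "liouville_primitive n A f h"
  shows "liouville_primitive n (copy_atlas A) copy_map (h \<circ> base)"
  unfolding liouville_primitive_def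
proof (intro conjI ballI allI)
  show "smooth_fun n (copy_atlas A) (h \<circ> base)"
    using assms smooth_fun_copies[OF atlas, of h "h \<circ> base" "\<lambda>_. 0"] by (simp add: liouville_primitive_def)
  fix c' y v
  assume "c' \<in> copy_atlas A" "y \<in> fst c'"
  then obtain i c p where *: "i < m" "c \<in> A" "c' = copy_chart i c" "p \<in> fst c" "p \<in> topspace X" "y = e i p"
    by (rule copy_atlas_cases)
  have "diff_fun n c' (h \<circ> base) y v = diff_fun n c h p v"
    unfolding * using * by (intro diff_fun_copy[OF _ chart, where a = 0]) auto
  then show "diff_fun n c' (h \<circ> base) y v = (\<Sum>j<n. Im (copy_map y j) * Re (diff_map n c' copy_map y v j))"
    using assms * by (simp add: liouville_primitive_def diff_map_copy)
qed

lemma exact_lagrangian_immersion_copies: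
  assumes "exact_lagrangian_immersion n X A f"
  shows "exact_lagrangian_immersion n copies (copy_atlas A) copy_map"
proof -
  obtain h where "lagrangian_immersion n X A f" "liouville_primitive n A f h"
    using assms by (auto simp: exact_lagrangian_immersion_def)
  from lagrangian_immersion_copies[OF this(1)] liouville_primitive_copies[OF this(2)] show ?thesis
    unfolding exact_lagrangian_immersion_def by blast
qed

lemma self_transverse_copies:
  assumes "self_transverse n X A f"
  shows "self_transverse n copies (copy_atlas A) copy_map"
  unfolding self_transverse_def
proof (intro allI impI)
  fix S w
  assume *: "finite S \<and> S \<subseteq> topspace copies \<and> (\<forall>p\<in>S. \<forall>q\<in>S. copy_map p = copy_map q) \<and>
    (\<forall>p\<in>S. w p \<in> complex_space n)"
  then have fin: "finite S" and S: "S \<subseteq> topspace copies"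
    and same: "\<forall>p\<in>S. \<forall>q\<in>S. copy_map p = copy_map q" and w: "\<forall>p\<in>S. w p \<in> complex_space n"
    by - (elim conjE, assumption)+
  show "\<exists>u\<in>complex_space n. \<forall>p\<in>S. (\<lambda>j. w p j - u j) \<in> tangent_image n (copy_atlas A) copy_map p"
  proof (cases "S = {}")
    case True
    have "(\<lambda>_. 0) \<in> complex_space n"
      by (simp add: complex_space_def)
    with True show ?thesis
      by blast
  next
    case False
    then obtain y where y: "y \<in> S"
      by blast
    then obtain i p where p: "i < m" "p \<in> topspace X" "y = e i p"
      using S by (meson copies_cases subsetD)
    \<comment> \<open>Points with a common image lie in the same copy.\<close>
    have "z \<in> e i ` topspace X" if z: "z \<in> S" for z
    proof -
      obtain j q where q: "j < m" "q \<in> topspace X" "z = e j q"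
        using S z by (meson copies_cases subsetD)
      then show ?thesis
        using bspec[OF bspec[OF same y] z] p copy_map_eq_iff[of i j p q] by simp
    qed
    then obtain S' where S': "S' \<subseteq> topspace X" "S = e i ` S'"
      by (meson subset_image_iff subsetI)
    have inj: "inj_on (e i) S'"
      using e_inject p(1) S'(1) by (auto simp: inj_on_def subset_iff)
    have "finite S'"
      using fin S'(2) inj finite_image_iff by blast
    moreover have "\<forall>p\<in>S'. \<forall>q\<in>S'. f p = f q"
    proof (intro ballI)
      fix a b assume "a \<in> S'" "b \<in> S'"
      then show "f a = f b"
        using same[rule_format, of "e i a" "e i b"] S' copy_map_eq_iff[OF p(1) p(1), of a b] by blast
    qed
    moreover have "\<forall>q\<in>S'. (w \<circ> e i) q \<in> complex_space n"
      using w S'(2) by simp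
    ultimately have "\<exists>u\<in>complex_space n. \<forall>q\<in>S'. (\<lambda>j. (w \<circ> e i) q j - u j) \<in> tangent_image n A f q"
      by (intro assms[unfolded self_transverse_def, rule_format] conjI S'(1))
    then obtain u where u: "u \<in> complex_space n"
      "\<forall>q\<in>S'. (\<lambda>j. w (e i q) j - u j) \<in> tangent_image n A f q"
      by auto
    show ?thesis
    proof (intro bexI[OF _ u(1)] ballI)
      fix z assume "z \<in> S"
      then obtain q where q: "q \<in> S'" "z = e i q"
        using S' by blast
      moreover from q have "q \<in> topspace X"
        using S' by blast
      ultimately show "(\<lambda>j. w z j - u j) \<in> tangent_image n (copy_atlas A) copy_map z"
        using u(2) p(1) by (simp add: tangent_image_copy)
    qed
  qed
qed

text \<open>
  The domain is compact and the target is Hausdorff, so continuity and injectivity suffice. Points in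
  different copies have different images already under the immersion.
\<close>

lemma legendrian_lift_copies:
  fixes h :: "'a \<Rightarrow> real"
  assumes "embedding_map X euclidean (\<lambda>p. (f p, h p))"
  shows "embedding_map copies euclidean (\<lambda>y. (copy_map y, h (base y)))"
proof (rule injective_closed_imp_embedding_map)
  have lift: "continuous_map X euclidean (\<lambda>p. (f p, h p))"
    by (rule embedding_imp_continuous_map[OF assms])
  show cont: "continuous_map copies euclidean (\<lambda>y. (copy_map y, h (base y)))"
  proof (rule continuous_map_copies)
    fix i assume i: "i < m"
    have coordinate: "continuous_on UNIV (\<lambda>x :: (nat \<Rightarrow> complex) \<times> real. fst x j)" for j
      by (rule continuous_on_product_then_coordinatewise) (rule continuous_on_fst[OF continuous_on_id])
    have "continuous_on UNIV (\<lambda>x :: (nat \<Rightarrow> complex) \<times> real. translate (real i * T) (fst x) j)" for j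
      by (cases "j = 0") (auto simp: translate_def intro!: continuous_intros coordinate)
    then have "continuous_map euclidean euclidean (\<lambda>(z, t :: real). (translate (real i * T) z, t))"
      unfolding continuous_map_iff_continuous2 case_prod_beta
      by (intro continuous_on_Pair)
         (rule continuous_on_coordinatewise_then_product, blast,
          rule continuous_on_snd[OF continuous_on_id])
    from continuous_map_compose[OF lift this]
    have "continuous_map X euclidean ((\<lambda>(z, t). (translate (real i * T) z, t)) \<circ> (\<lambda>p. (f p, h p)))" .
    then show "continuous_map X euclidean (\<lambda>p. (copy_map (e i p), h (base (e i p))))"
      by (rule continuous_map_eq) (use i in auto)
  qed
  show "closed_map copies euclidean (\<lambda>y. (copy_map y, h (base y)))"
    using manifold compact_space_copies cont
    by (intro continuous_imp_closed_map) (simp_all add: closed_manifold_def)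
  have inj: "inj_on (\<lambda>p. (f p, h p)) (topspace X)"
    by (rule embedding_imp_injective_map[OF assms])
  show "inj_on (\<lambda>y. (copy_map y, h (base y))) (topspace copies)"
  proof (rule inj_onI)
    fix y z
    assume "y \<in> topspace copies" "z \<in> topspace copies" and eq: "(copy_map y, h (base y)) = (copy_map z, h (base z))"
    then obtain i p j q where p: "i < m" "p \<in> topspace X" "y = e i p"
      and q: "j < m" "q \<in> topspace X" "z = e j q"
      by (metis copies_cases)
    then have "i = j" "f p = f q" "h p = h q"
      using eq copy_map_eq_iff[OF p(1) q(1) p(2) q(2)] by simp_all
    then have "p = q"
      using inj_onD[OF inj, of p q] p q by simp
    then show "y = z"
      using p q \<open>i = j\<close> by simp
  qed
qed

lemma chord_generic_copies:
  assumes "chord_generic n X A f"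
  shows "chord_generic n copies (copy_atlas A) copy_map"
  unfolding chord_generic_def
proof (intro conjI ballI impI)
  show "\<exists>h. liouville_primitive n (copy_atlas A) copy_map h \<and> embedding_map copies euclidean (\<lambda>p. (copy_map p, h p))"
  proof -
    obtain h where "liouville_primitive n A f h" "embedding_map X euclidean (\<lambda>p. (f p, h p))"
      using assms unfolding chord_generic_def by (elim conjE exE) (rule that)
    from liouville_primitive_copies[OF this(1)] legendrian_lift_copies[OF this(2)] show ?thesis
      by (intro exI[of _ "h \<circ> base"]) simp
  qed
next
  fix y z u
  assume "y \<in> topspace copies" "z \<in> topspace copies" and yz: "y \<noteq> z \<and> copy_map y = copy_map z"
    and u: "u \<in> complex_space n"
  then obtain i p j q where p: "i < m" "p \<in> topspace X" "y = e i p"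
    and q: "j < m" "q \<in> topspace X" "z = e j q"
    by (metis copies_cases)
  then have "p \<noteq> q" "f p = f q"
    using yz copy_map_eq_iff[OF p(1) q(1) p(2) q(2)] by auto
  then have "\<exists>v\<in>tangent_image n A f p. \<exists>w\<in>tangent_image n A f q. u = (\<lambda>j. v j + w j)"
    using assms[unfolded chord_generic_def, THEN conjunct2] p(2) q(2) u by blast
  then show "\<exists>v\<in>tangent_image n (copy_atlas A) copy_map y. \<exists>w\<in>tangent_image n (copy_atlas A) copy_map z.
      u = (\<lambda>j. v j + w j)"
    unfolding p(3) q(3) tangent_image_copy[OF p(1,2)] tangent_image_copy[OF q(1,2)] .
qed

lemma num_double_points_copies:
  assumes "finite (double_points X f)"
  shows "num_double_points copies copy_map \<le> ereal (real m) * num_double_points X f"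
proof -
  let ?D = "\<Union>i<m. translate (real i * T) ` double_points X f"
  have sub: "double_points copies copy_map \<subseteq> ?D"
  proof
    fix x assume "x \<in> double_points copies copy_map"
    then obtain y z where "y \<in> topspace copies" "z \<in> topspace copies"
      and yz: "y \<noteq> z" "copy_map y = copy_map z" "x = copy_map y"
      unfolding double_points_def by auto
    then obtain i p j q where p: "i < m" "p \<in> topspace X" "y = e i p"
      and q: "j < m" "q \<in> topspace X" "z = e j q"
      by (metis copies_cases)
    then have "p \<noteq> q" "f p = f q"
      using yz copy_map_eq_iff[OF p(1) q(1) p(2) q(2)] by auto
    then have "f p \<in> double_points X f"
      using p q by (auto simp: double_points_def)
    moreover have "x = translate (real i * T) (f p)"
      using p yz(3) by simp
    ultimately show "x \<in> ?D"
      using p(1) by blast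
  qed
  have fin: "finite ?D"
    using assms by blast
  have card: "card ?D \<le> m * card (double_points X f)"
  proof -
    have "card ?D \<le> (\<Sum>i<m. card (translate (real i * T) ` double_points X f))"
      by (rule card_UN_le) simp
    also have "\<dots> \<le> (\<Sum>i<m. card (double_points X f))"
      by (intro sum_mono card_image_le assms)
    finally show ?thesis
      by simp
  qed
  have "finite (double_points copies copy_map)"
    by (rule finite_subset[OF sub fin])
  have "card (double_points copies copy_map) \<le> m * card (double_points X f)"
    using card_mono[OF fin sub] card by (rule le_trans)
  then have "real (card (double_points copies copy_map)) \<le> real m * real (card (double_points X f))"
    by (metis of_nat_le_iff of_nat_mult)
  then show ?thesis
    using assms \<open>finite (double_points copies copy_map)\<close> by (simp add: num_double_points_def)
qed

lemma homology_dims_copies: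
  assumes "d \<in> homology_dims n X A"
  shows "\<exists>d'\<in>homology_dims n copies (copy_atlas A). ereal (real m) * d \<le> d'"
proof (cases "spin n X A")
  case True
  then have "spin n copies (copy_atlas A)"
    using spin_copies atlas by blast
  then have "total_homology_dim rational_field copies \<in> homology_dims n copies (copy_atlas A)"
    and "\<And>p. prime p \<Longrightarrow> total_homology_dim (residue_ring (int p)) copies \<in> homology_dims n copies (copy_atlas A)"
    by (auto simp: homology_dims_def)
  then show ?thesis
    using assms True total_homology_dim_copies[OF ring_rational_field]
      total_homology_dim_copies[OF ring_residue_ring]
    by (auto simp: homology_dims_def)
next
  case False
  \<comment> \<open>The field with two elements is admissible whether or not the disjoint union is spin.\<close>
  have "total_homology_dim (residue_ring 2) copies \<in> homology_dims n copies (copy_atlas A)"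
    by (auto simp: homology_dims_def intro!: exI[of _ 2])
  moreover have "ring (residue_ring 2)"
    using ring_residue_ring[of 2] by simp
  moreover have "d = total_homology_dim (residue_ring 2) X"
    using assms False by (simp add: homology_dims_def)
  ultimately show ?thesis
    using total_homology_dim_copies[of "residue_ring 2"] by (intro bexI) simp_all
qed

end

section \<open>Letting the number of copies grow\<close>

lemma ereal_le_of_multiples_le_add_const:
  fixes d N :: ereal
  assumes "\<And>m :: nat. m \<ge> 1 \<Longrightarrow> ereal (1 / 2) * (ereal (real m) * d) - ereal K \<le> ereal (real m) * N"
    and "N \<noteq> - \<infinity>"
  shows "ereal (1 / 2) * d \<le> N"
proof (cases "N = \<infinity> \<or> d = - \<infinity>")
  case False
  then obtain s where N: "N = ereal s"
    using assms(2) by (cases N) auto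
  have "d \<noteq> \<infinity>"
    using assms(1)[of 1] N by auto
  then obtain r where d: "d = ereal r"
    using False by (cases d) auto
  have le: "real m * (r / 2 - s) \<le> K" if "m \<ge> 1" for m
    using assms(1)[OF that] by (simp add: N d algebra_simps)
  have "r / 2 \<le> s"
  proof (rule ccontr)
    assume "\<not> r / 2 \<le> s"
    then obtain m :: nat where "K < real m * (r / 2 - s)"
      using reals_Archimedean3[of "r / 2 - s"] by auto
    also have "\<dots> \<le> real (Suc m) * (r / 2 - s)"
      using \<open>\<not> r / 2 \<le> s\<close> by (intro mult_right_mono) auto
    finally show False
      using le[of "Suc m"] by simp
  qed
  then show ?thesis
    by (simp add: N d)
qed auto

text \<open>
  If the coordinate \<open>x\<^sub>0\<close> is bounded by \<open>B\<close> on the compact image, then two translates by different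
  multiples of \<open>2 \<bar>B\<bar> + 1\<close> cannot meet.
\<close>

lemma exists_separating_distance:
  assumes "compact_space X" "continuous_map X euclidean f"
  shows "\<exists>T :: real. \<forall>i j. \<forall>p\<in>topspace X. \<forall>q\<in>topspace X.
    translate (real i * T) (f p) = translate (real j * T) (f q) \<longrightarrow> i = j"
proof -
  have "continuous_map X euclidean ((\<lambda>z. Re (z 0)) \<circ> f)"
  proof (rule continuous_map_compose[OF assms(2)])
    have "continuous_on UNIV (\<lambda>z :: nat \<Rightarrow> complex. Re (z 0))"
      by (intro continuous_intros continuous_on_product_coordinates)
    then show "continuous_map euclidean euclidean (\<lambda>z :: nat \<Rightarrow> complex. Re (z 0))"
      by simp
  qed
  then have "compactin euclidean (((\<lambda>z. Re (z 0)) \<circ> f) ` topspace X)"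
    using assms(1) image_compactin by (metis compact_space_def)
  then have "bounded (((\<lambda>z. Re (z 0)) \<circ> f) ` topspace X)"
    by (simp add: compact_imp_bounded)
  then obtain B where B: "\<And>p. p \<in> topspace X \<Longrightarrow> \<bar>Re (f p 0)\<bar> \<le> B"
    by (auto simp: bounded_iff)
  define T where "T = 2 * \<bar>B\<bar> + 1"
  show ?thesis
  proof (intro exI[of _ T] allI ballI impI)
    fix i j p q
    assume p: "p \<in> topspace X" "q \<in> topspace X"
      and eq: "translate (real i * T) (f p) = translate (real j * T) (f q)"
    have "Re (f p 0) + real i * T = Re (f q 0) + real j * T"
      using arg_cong[OF eq, of "\<lambda>z. Re (z 0)"] by (simp add: Re_translate)
    then have "(real i - real j) * T = Re (f q 0) - Re (f p 0)"
      by (simp add: algebra_simps)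
    then have "\<bar>(real i - real j) * T\<bar> = \<bar>Re (f q 0) - Re (f p 0)\<bar>"
      by (rule arg_cong)
    then have "\<bar>real i - real j\<bar> * T = \<bar>Re (f q 0) - Re (f p 0)\<bar>"
      by (simp add: abs_mult T_def)
    also have "\<dots> < T"
      using B[OF p(1)] B[OF p(2)] by (simp add: T_def)
    finally have "\<bar>real i - real j\<bar> * T < 1 * T"
      by simp
    then have "\<bar>real i - real j\<bar> < 1"
      by (rule mult_right_less_imp_less) (simp add: T_def)
    then show "i = j"
      by linarith
  qed
qed

text \<open>
  The copy in entry 0, the height in entry 1, and after that the real and imaginary parts of the
  coordinates alternately.
\<close>

definition encode :: "nat \<Rightarrow> (nat \<Rightarrow> complex) \<times> real \<Rightarrow> nat \<Rightarrow> real" where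
  "encode i x = case_nat (real i) (case_nat (snd x)
     (\<lambda>k. if even k then Re (fst x (k div 2)) else Im (fst x (k div 2))))"

lemma encode_eq_iff [simp]: "encode i x = encode j y \<longleftrightarrow> i = j \<and> x = y"
proof
  assume eq: "encode i x = encode j y"
  have "i = j" "snd x = snd y"
    using fun_cong[OF eq, of 0] fun_cong[OF eq, of 1] by (simp_all add: encode_def)
  moreover have "fst x k = fst y k" for k
    using fun_cong[OF eq, of "Suc (Suc (2 * k))"] fun_cong[OF eq, of "Suc (Suc (Suc (2 * k)))"]
    by (simp add: encode_def complex_eq_iff)
  ultimately show "i = j \<and> x = y"
    by (auto simp: prod_eq_iff)
qed simp

theorem theorem6p2:
  assumes "\<exists>K :: real. \<forall>n (X :: (nat \<Rightarrow> real) topology) A f.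
             n \<ge> 1 \<and> closed_manifold n X A \<and> exact_lagrangian_immersion n X A f \<and>
             self_transverse n X A f \<and> chord_generic n X A f \<longrightarrow>
             (\<forall>d\<in>homology_dims n X A. ereal (1 / 2) * d - ereal K \<le> num_double_points X f)"
  shows "\<forall>n (X :: 'a topology) A f.
             n \<ge> 1 \<and> closed_manifold n X A \<and> exact_lagrangian_immersion n X A f \<and>
             self_transverse n X A f \<and> chord_generic n X A f \<longrightarrow>
             (\<forall>d\<in>homology_dims n X A. ereal (1 / 2) * d \<le> num_double_points X f)"
proof (intro allI impI ballI, elim conjE)
  obtain K :: real where K: "\<forall>n (X :: (nat \<Rightarrow> real) topology) A f.
      n \<ge> 1 \<and> closed_manifold n X A \<and> exact_lagrangian_immersion n X A f \<and>
      self_transverse n X A f \<and> chord_generic n X A f \<longrightarrow>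
      (\<forall>d\<in>homology_dims n X A. ereal (1 / 2) * d - ereal K \<le> num_double_points X f)"
    using assms by (elim exE)
  fix n :: nat and X :: "'a topology" and A :: "'a chart set" and f d
  assume n: "1 \<le> n" and X: "closed_manifold n X A" and exact: "exact_lagrangian_immersion n X A f"
    and transverse: "self_transverse n X A f" and chord: "chord_generic n X A f"
    and d: "d \<in> homology_dims n X A"
  obtain h :: "'a \<Rightarrow> real" where h: "embedding_map X euclidean (\<lambda>p. (f p, h p))"
    using chord unfolding chord_generic_def by (elim conjE exE) (rule that)
  have inj: "inj_on (\<lambda>p. (f p, h p)) (topspace X)"
    by (rule embedding_imp_injective_map[OF h])
  have "continuous_map X euclidean (fst \<circ> (\<lambda>p. (f p, h p)))"
    by (rule continuous_map_compose[OF embedding_imp_continuous_map[OF h]])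
       (simp add: continuous_on_fst)
  then have cont: "continuous_map X euclidean f"
    by (simp add: comp_def)
  have compact: "compact_space X"
    using X by (simp add: closed_manifold_def)
  obtain T where T: "\<forall>i j. \<forall>p\<in>topspace X. \<forall>q\<in>topspace X.
      translate (real i * T) (f p) = translate (real j * T) (f q) \<longrightarrow> i = j"
    using exists_separating_distance[OF compact cont] by (elim exE) (rule that)
  have "ereal (1 / 2) * (ereal (real m) * d) - ereal K \<le> ereal (real m) * num_double_points X f"
    if "m \<ge> 1" for m
  proof (cases "finite (double_points X f)")
    case True
    interpret immersion_copies m X "\<lambda>i p. encode i (f p, h p)" n A f T
    proof
      fix i j p q assume "p \<in> topspace X" "q \<in> topspace X"
      then show "encode i (f p, h p) = encode j (f q, h q) \<longleftrightarrow> i = j \<and> p = q"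
        using inj_onD[OF inj, of p q] by auto
    qed (rule n, rule X, rule T[rule_format])
    obtain d' where d': "d' \<in> homology_dims n copies (copy_atlas A)" "ereal (real m) * d \<le> d'"
      using homology_dims_copies[OF d] by (elim bexE) (rule that)
    have "ereal (1 / 2) * (ereal (real m) * d) - ereal K \<le> ereal (1 / 2) * d' - ereal K"
      using d'(2) by (intro ereal_minus_mono ereal_mult_left_mono) auto
    also have "\<dots> \<le> num_double_points copies copy_map"
      using n closed_manifold_copies[OF X] exact_lagrangian_immersion_copies[OF exact]
        self_transverse_copies[OF transverse] chord_generic_copies[OF chord] d'(1)
      by (intro K[rule_format] conjI)
    also have "\<dots> \<le> ereal (real m) * num_double_points X f"
      by (rule num_double_points_copies[OF True])
    finally show ?thesis .
  next
    case False
    then show ?thesis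
      using that by (simp add: num_double_points_def)
  qed
  moreover have "num_double_points X f \<noteq> - \<infinity>"
    by (simp add: num_double_points_def)
  ultimately show "ereal (1 / 2) * d \<le> num_double_points X f"
    by (rule ereal_le_of_multiples_le_add_const)
qed

end
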